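(* Let $n\ge 1$, let $\Omega\subset\mathbb{R}^n$ be a bounded domain of class $C^{2+\nu}$ for some $\nu>0$, let $p>0$, and let $f:\overline\Omega\to[0,\infty)$ be a nonnegative Hölder continuous function with $f\not\equiv 0$. Let $u$ be the unique maximal classical solution, with maximal existence time $T$, of $$u_t=\Delta u+f(x)(1-u)^{-p}\ \ (x\in\Omega,\ t>0),\qquad u=0\ \ (x\in\partial\Omega,\ t>0),\qquad u(x,0)=0\ \ (x\in\Omega),$$ and assume $T<\infty$. If $x_0\in\Omega$ is such that $f(x_0)=0$, then $x_0$ is not a quenching point of $u$.
   Context: The problem has a unique classical solution $u$ (with $u<1$) on a short time interval, and it can be continued as long as $\max_{x\in\overline\Omega}u(x,t)<1$. $[0,T)$, $T\le\infty$, denotes its maximal existence interval. If $T<\infty$ then $\limsup_{t\to T^-}\max_{x\in\overline\Omega}u(x,t)=1$ (finite-time quenching). When $T<\infty$, a point $x_0\in\overline\Omega$ is called a quenching point if there is a sequence $(x_k,t_k)\in\overline\Omega\times(0,T)$ with $x_k\to x_0$, $t_k\uparrow T$ and $u(x_k,t_k)\to1$ as $k\to\infty$. *)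

theory Defs
  imports "HOL-Analysis.Analysis"
begin

definition holder_with :: "real \<Rightarrow> 'a::metric_space set \<Rightarrow> ('a \<Rightarrow> real) \<Rightarrow> bool" where
  "holder_with \<alpha> S g \<longleftrightarrow> (\<exists>C. \<forall>x\<in>S. \<forall>y\<in>S. \<bar>g x - g y\<bar> \<le> C * dist x y powr \<alpha>)"

definition holder_continuous_on :: "'a::metric_space set \<Rightarrow> ('a \<Rightarrow> real) \<Rightarrow> bool" where
  "holder_continuous_on S g \<longleftrightarrow> (\<exists>\<alpha>. 0 < \<alpha> \<and> \<alpha> \<le> 1 \<and> holder_with \<alpha> S g)"

(* Partial derivative in the coordinate direction b; it is meaningful when has_partial holds. *)

definition partial :: "'a::euclidean_space \<Rightarrow> ('a \<Rightarrow> real) \<Rightarrow> 'a \<Rightarrow> real" where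
  "partial b g x = deriv (\<lambda>s. g (x + s *\<^sub>R b)) 0"

definition has_partial :: "'a::euclidean_space \<Rightarrow> ('a \<Rightarrow> real) \<Rightarrow> 'a \<Rightarrow> bool" where
  "has_partial b g x \<longleftrightarrow> (\<lambda>s. g (x + s *\<^sub>R b)) field_differentiable (at 0)"

definition laplacian :: "('a::euclidean_space \<Rightarrow> real) \<Rightarrow> 'a \<Rightarrow> real" where
  "laplacian g x = (\<Sum>b\<in>Basis. partial b (partial b g) x)"

(* Intended for open S, so that the partial derivatives at points of S only depend on g on S. *)

definition C2_on :: "'a::euclidean_space set \<Rightarrow> ('a \<Rightarrow> real) \<Rightarrow> bool" where
  "C2_on S g \<longleftrightarrow>
     continuous_on S g \<and>
     (\<forall>b\<in>Basis. (\<forall>x\<in>S. has_partial b g x) \<and> continuous_on S (partial b g)) \<and>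
     (\<forall>b\<in>Basis. \<forall>c\<in>Basis.
        (\<forall>x\<in>S. has_partial c (partial b g) x) \<and> continuous_on S (partial c (partial b g)))"

definition C2_holder_on :: "real \<Rightarrow> 'a::euclidean_space set \<Rightarrow> ('a \<Rightarrow> real) \<Rightarrow> bool" where
  "C2_holder_on \<nu> S g \<longleftrightarrow>
     C2_on S g \<and> (\<forall>b\<in>Basis. \<forall>c\<in>Basis. holder_with \<nu> S (partial c (partial b g)))"

(* Bounded domain of class C^(2+nu), 0 < nu \<le> 1: near each boundary point the domain is the set
   above the graph of a C^(2+nu) function, in coordinates rotated so that the unit vector e points
   upwards.  The graph function is only evaluated on the hyperplane orthogonal to e, where
   x - (x \<bullet> e) e is the projection of x; it is given on the whole space (say, constant along e) to
   avoid a type of dimension n - 1, which does not exist for n = 1.  Asking for a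
   global graph function with a global Hoelder bound is no restriction, by a cut-off. *)

definition C2_holder_domain :: "real \<Rightarrow> 'a::euclidean_space set \<Rightarrow> bool" where
  "C2_holder_domain \<nu> \<Omega> \<longleftrightarrow>
     open \<Omega> \<and> connected \<Omega> \<and> \<Omega> \<noteq> {} \<and> bounded \<Omega> \<and>
     (\<forall>z\<in>frontier \<Omega>. \<exists>r>0. \<exists>e \<gamma>.
        norm e = 1 \<and> C2_holder_on \<nu> UNIV \<gamma> \<and>
        \<Omega> \<inter> ball z r = {x \<in> ball z r. x \<bullet> e > \<gamma> (x - (x \<bullet> e) *\<^sub>R e)})"

(* The class C^(2,1) on \<Omega> \<times> I, for \<Omega> and I open: all derivatives are jointly continuous. *)

definition C21_on :: "'a::euclidean_space set \<Rightarrow> real set \<Rightarrow> ('a \<Rightarrow> real \<Rightarrow> real) \<Rightarrow> bool" where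
  "C21_on \<Omega> I u \<longleftrightarrow>
     continuous_on (\<Omega> \<times> I) (\<lambda>(x, t). u x t) \<and>
     (\<forall>x\<in>\<Omega>. \<forall>t\<in>I. u x field_differentiable (at t)) \<and>
     continuous_on (\<Omega> \<times> I) (\<lambda>(x, t). deriv (u x) t) \<and>
     (\<forall>t\<in>I. C2_on \<Omega> (\<lambda>x. u x t)) \<and>
     (\<forall>b\<in>Basis. continuous_on (\<Omega> \<times> I) (\<lambda>(x, t). partial b (\<lambda>y. u y t) x)) \<and>
     (\<forall>b\<in>Basis. \<forall>c\<in>Basis.
        continuous_on (\<Omega> \<times> I) (\<lambda>(x, t). partial c (partial b (\<lambda>y. u y t)) x))"

definition classical_solution ::
  "'a::euclidean_space set \<Rightarrow> real \<Rightarrow> ('a \<Rightarrow> real) \<Rightarrow> ereal \<Rightarrow> ('a \<Rightarrow> real \<Rightarrow> real) \<Rightarrow> bool" where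
  "classical_solution \<Omega> p f T u \<longleftrightarrow>
     continuous_on (closure \<Omega> \<times> {t. 0 \<le> t \<and> ereal t < T}) (\<lambda>(x, t). u x t) \<and>
     C21_on \<Omega> {t. 0 < t \<and> ereal t < T} u \<and>
     (\<forall>x\<in>closure \<Omega>. \<forall>t. 0 \<le> t \<and> ereal t < T \<longrightarrow> u x t < 1) \<and>
     (\<forall>x\<in>\<Omega>. \<forall>t. 0 < t \<and> ereal t < T \<longrightarrow>
        deriv (u x) t = laplacian (\<lambda>y. u y t) x + f x * (1 - u x t) powr (- p)) \<and>
     (\<forall>x\<in>frontier \<Omega>. \<forall>t. 0 < t \<and> ereal t < T \<longrightarrow> u x t = 0) \<and>
     (\<forall>x\<in>\<Omega>. u x 0 = 0)"

(* Values of u outside closure \<Omega> \<times> [0, T) are irrelevant. *)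

definition maximal_classical_solution ::
  "'a::euclidean_space set \<Rightarrow> real \<Rightarrow> ('a \<Rightarrow> real) \<Rightarrow> ereal \<Rightarrow> ('a \<Rightarrow> real \<Rightarrow> real) \<Rightarrow> bool" where
  "maximal_classical_solution \<Omega> p f T u \<longleftrightarrow>
     0 < T \<and> classical_solution \<Omega> p f T u \<and>
     \<not> (\<exists>T' v. T < T' \<and> classical_solution \<Omega> p f T' v \<and>
            (\<forall>x\<in>closure \<Omega>. \<forall>t. 0 \<le> t \<and> ereal t < T \<longrightarrow> v x t = u x t))"

definition quenching_point ::
  "'a::euclidean_space set \<Rightarrow> ereal \<Rightarrow> ('a \<Rightarrow> real \<Rightarrow> real) \<Rightarrow> 'a \<Rightarrow> bool" where
  "quenching_point \<Omega> T u x0 \<longleftrightarrow>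
     x0 \<in> closure \<Omega> \<and>
     (\<exists>x t. (\<forall>k::nat. x k \<in> closure \<Omega> \<and> 0 < t k \<and> ereal (t k) < T) \<and>
            x \<longlonglongrightarrow> x0 \<and> incseq t \<and> (\<lambda>k. ereal (t k)) \<longlonglongrightarrow> T \<and>
            (\<lambda>k. u (x k) (t k)) \<longlonglongrightarrow> 1)"

end

theory Submission
  imports Defs
begin

text \<open>Two scale-invariant bounds compete near a zero \<open>x0\<close> of \<open>f\<close>. Since \<open>u\<^sub>t > 0\<close> inside the domain
  (strong maximum principle), comparing \<open>u\<^sub>t\<close> with \<open>\<epsilon> exp (- \<gamma> t) \<beta> powr (p + 1) * (1 - u) powr (- p)\<close>,
  where \<open>\<beta>\<close> is supported in a ball and \<open>\<Delta>\<beta> + \<kappa>\<beta> \<ge> 0\<close> there, gives an interior estimate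
  \<open>1 - u \<ge> c (T - t) powr (1 / (p + 1))\<close>. On a ball of radius \<open>r\<close> around \<open>x0\<close> the source is therefore at
  most \<open>\<eta> c powr (- p) * (T - t) powr (- p / (p + 1))\<close> with \<open>\<eta> = sup f\<close> small; during the final time span \<open>r\<^sup>2\<close>
  it adds to \<open>u\<close> less than what the heat flow preserves of the initial deficit.

  As \<open>f\<close> is only Hoelder continuous, \<open>u\<^sub>t\<close> need not solve an equation classically. It is replaced by the increments
  \<open>u (t + h) - u (t)\<close>, which are supersolutions of the linearized equation because \<open>(1 - u) powr (- p)\<close>
  is convex, with bounds uniform in \<open>h\<close>.\<close>

subsection \<open>A minimum principle for touching functions\<close>

text \<open>A relation with explicit witnesses instead of an iterated \<open>deriv\<close>: it asks
  for differentiability only near 0 and passes to linear combinations without further side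
  conditions.\<close>

definition second_deriv_at0 :: "(real \<Rightarrow> real) \<Rightarrow> real \<Rightarrow> bool" where
  "second_deriv_at0 \<phi> l \<longleftrightarrow>
     (\<exists>\<phi>'. (\<forall>\<^sub>F s in nhds 0. (\<phi> has_real_derivative \<phi>' s) (at s)) \<and> (\<phi>' has_real_derivative l) (at 0))"

lemma second_deriv_at0_const: "second_deriv_at0 (\<lambda>s. c) 0"
  unfolding second_deriv_at0_def by (intro exI[of _ "\<lambda>s. 0"]) auto

lemma second_deriv_at0_lincomb:
  assumes "second_deriv_at0 \<phi> k" "second_deriv_at0 \<eta> l"
  shows "second_deriv_at0 (\<lambda>s. a * \<phi> s + b * \<eta> s) (a * k + b * l)"
proof -
  obtain \<phi>' \<eta>' where h: "\<forall>\<^sub>F s in nhds 0. (\<phi> has_real_derivative \<phi>' s) (at s)"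
    "\<forall>\<^sub>F s in nhds 0. (\<eta> has_real_derivative \<eta>' s) (at s)"
    and d: "(\<phi>' has_real_derivative k) (at 0)" "(\<eta>' has_real_derivative l) (at 0)"
    using assms unfolding second_deriv_at0_def by blast
  have "\<forall>\<^sub>F s in nhds 0. ((\<lambda>s. a * \<phi> s + b * \<eta> s) has_real_derivative a * \<phi>' s + b * \<eta>' s) (at s)"
    using h by eventually_elim (auto intro!: derivative_eq_intros)
  moreover have "((\<lambda>s. a * \<phi>' s + b * \<eta>' s) has_real_derivative a * k + b * l) (at 0)"
    using d by (auto intro!: derivative_eq_intros)
  ultimately show ?thesis unfolding second_deriv_at0_def by (intro exI conjI)
qed

text \<open>The first derivative vanishes at a minimum. If \<open>l\<close> were negative, it would
  be negative just to the right of 0, and the function would drop strictly below its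
  minimum.\<close>

lemma second_deriv_at0_nonneg_at_min:
  assumes "second_deriv_at0 \<phi> l" "\<forall>\<^sub>F s in nhds 0. \<phi> 0 \<le> \<phi> s"
  shows "0 \<le> l"
proof (rule ccontr)
  assume "\<not> 0 \<le> l"
  then have l: "l < 0" by simp
  obtain \<phi>' where h: "\<forall>\<^sub>F s in nhds 0. (\<phi> has_real_derivative \<phi>' s) (at s)"
    and d: "(\<phi>' has_real_derivative l) (at 0)"
    using assms unfolding second_deriv_at0_def by blast
  obtain \<delta> where \<delta>: "\<delta> > 0"
    and \<delta>1: "\<And>s. \<bar>s\<bar> < \<delta> \<Longrightarrow> (\<phi> has_real_derivative \<phi>' s) (at s) \<and> \<phi> 0 \<le> \<phi> s"
    using eventually_conj[OF h assms(2)] unfolding eventually_nhds_metric by (auto simp: dist_real_def)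
  have z: "\<phi>' 0 = 0"
    using DERIV_local_min[of \<phi> "\<phi>' 0" 0 \<delta>] \<delta> \<delta>1 by simp
  obtain e where e: "e > 0" "\<And>s. s > 0 \<Longrightarrow> s < e \<Longrightarrow> \<phi>' s < 0"
    using DERIV_neg_dec_right[OF d l] z by auto
  define s where "s = min \<delta> e / 2"
  have s: "s > 0" "s < \<delta>" "s < e" using \<delta> e by (auto simp: s_def)
  have "\<phi> s < \<phi> 0"
  proof (rule DERIV_neg_imp_decreasing_open[OF s(1)])
    show "\<exists>y. (\<phi> has_real_derivative y) (at v) \<and> y < 0" if "0 < v" "v < s" for v
      using that s e(2)[of v] \<delta>1[of v] by auto
    have "isCont \<phi> v" if "v \<in> {0..s}" for v
      using that s \<delta>1[of v] by (auto intro: DERIV_isCont)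
    then show "continuous_on {0..s} \<phi>" by (simp add: continuous_at_imp_continuous_on)
  qed
  with \<delta>1[of s] s show False by auto
qed

section \<open>The heat operator at a point\<close>

text \<open>\<open>H\<close> is the value at \<open>(x, t)\<close> of the time derivative minus the
  Laplacian. Only derivatives along the time axis and the coordinate lines through the point enter,
  so solutions, their increments and explicit barriers are all handled by the same rules.\<close>

definition heat_at :: "('a::euclidean_space \<Rightarrow> real \<Rightarrow> real) \<Rightarrow> 'a \<Rightarrow> real \<Rightarrow> real \<Rightarrow> bool" where
  "heat_at \<psi> x t H \<longleftrightarrow>
     (\<exists>d l. (\<psi> x has_real_derivative d) (at t) \<and>
            (\<forall>b\<in>Basis. second_deriv_at0 (\<lambda>s. \<psi> (x + s *\<^sub>R b) t) (l b)) \<and> H = d - sum l Basis)"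

lemma heat_atI:
  assumes "(\<psi> x has_real_derivative d) (at t)"
    and "\<And>b. b \<in> Basis \<Longrightarrow> second_deriv_at0 (\<lambda>s. \<psi> (x + s *\<^sub>R b) t) (l b)"
    and "H = d - sum l Basis"
  shows "heat_at \<psi> x t H"
  using assms unfolding heat_at_def by blast

lemma heat_at_lincomb:
  assumes "heat_at \<psi> x t H" "heat_at \<eta> x t K"
  shows "heat_at (\<lambda>x t. a * \<psi> x t + b * \<eta> x t) x t (a * H + b * K)"
proof -
  obtain d l d' l' where h: "(\<psi> x has_real_derivative d) (at t)" "(\<eta> x has_real_derivative d') (at t)"
    "\<And>b. b \<in> Basis \<Longrightarrow> second_deriv_at0 (\<lambda>s. \<psi> (x + s *\<^sub>R b) t) (l b)"
    "\<And>b. b \<in> Basis \<Longrightarrow> second_deriv_at0 (\<lambda>s. \<eta> (x + s *\<^sub>R b) t) (l' b)"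
    "H = d - sum l Basis" "K = d' - sum l' Basis"
    using assms unfolding heat_at_def by metis
  show ?thesis
    by (rule heat_atI[where d = "a * d + b * d'" and l = "\<lambda>i. a * l i + b * l' i"])
       (use h in \<open>auto intro!: derivative_eq_intros second_deriv_at0_lincomb
          simp: sum.distrib sum_distrib_left algebra_simps\<close>)
qed

lemma heat_at_time:
  assumes "(g has_real_derivative d) (at t)"
  shows "heat_at (\<lambda>x. g) x t d"
  by (rule heat_atI[OF assms second_deriv_at0_const]) simp

lemma heat_at_time_mult:
  assumes "heat_at \<psi> x t H" "(g has_real_derivative d) (at t)"
  shows "heat_at (\<lambda>x t. g t * \<psi> x t) x t (d * \<psi> x t + g t * H)"
proof -
  obtain e l where h: "(\<psi> x has_real_derivative e) (at t)" 
    "\<And>b. b \<in> Basis \<Longrightarrow> second_deriv_at0 (\<lambda>s. \<psi> (x + s *\<^sub>R b) t) (l b)"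
    "H = e - sum l Basis"
    using assms unfolding heat_at_def by metis
  show ?thesis
  proof (rule heat_atI[where d = "d * \<psi> x t + g t * e" and l = "\<lambda>i. g t * l i"])
    show "((\<lambda>t. g t * \<psi> x t) has_real_derivative d * \<psi> x t + g t * e) (at t)"
      using h assms(2) by (auto intro!: derivative_eq_intros)
    show "second_deriv_at0 (\<lambda>s. g t * \<psi> (x + s *\<^sub>R b) t) (g t * l b)" if "b \<in> Basis" for b
      using second_deriv_at0_lincomb[OF h(2)[OF that] second_deriv_at0_const[of 0], of "g t" 0] by simp
  qed (use h in \<open>auto simp: sum_distrib_left algebra_simps\<close>)
qed

lemma heat_at_time_shift:
  assumes "heat_at \<psi> x (t + h) H"
  shows "heat_at (\<lambda>x t. \<psi> x (t + h)) x t H"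
  using assms unfolding heat_at_def by (simp add: DERIV_shift)

lemma norm_line:
  fixes x y b :: "'a::euclidean_space"
  assumes "b \<in> Basis"
  shows "(norm (x + s *\<^sub>R b - y))\<^sup>2 = (norm (x - y))\<^sup>2 + 2 * s * ((x - y) \<bullet> b) + s\<^sup>2"
  using assms unfolding power2_norm_eq_inner
  by (simp add: inner_diff_left inner_diff_right inner_add_left inner_add_right inner_commute power2_eq_square algebra_simps)

lemma heat_at_quad:
  fixes x y :: "'a::euclidean_space"
  shows "heat_at (\<lambda>x t. c - (norm (x - y))\<^sup>2) x t (2 * DIM('a))"
proof (rule heat_atI[where d = 0 and l = "\<lambda>b. - 2"])
  fix b :: 'a assume b: "b \<in> Basis"
  show "second_deriv_at0 (\<lambda>s. c - (norm (x + s *\<^sub>R b - y))\<^sup>2) (- 2)"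
    unfolding second_deriv_at0_def norm_line[OF b]
    by (intro exI[of _ "\<lambda>s. - 2 * ((x - y) \<bullet> b) - 2 * s"] conjI always_eventually allI)
       (auto intro!: derivative_eq_intros)
qed auto

text \<open>For z = c - |x - y|^2 in dimension n, the Laplacian of z^2 is 2 |grad z|^2 + 2 z times
  the Laplacian of z, that is 8 |x - y|^2 - 4 n z.\<close>

lemma heat_at_quad_square:
  fixes x y :: "'a::euclidean_space"
  assumes "(c has_real_derivative d) (at t)"
  shows "heat_at (\<lambda>x t. (c t - (norm (x - y))\<^sup>2)\<^sup>2) x t
           (2 * (c t - (norm (x - y))\<^sup>2) * d - 8 * (norm (x - y))\<^sup>2
             + 4 * DIM('a) * (c t - (norm (x - y))\<^sup>2))"
proof -
  define z where "z = c t - (norm (x - y))\<^sup>2"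
  show ?thesis
  proof (rule heat_atI[where d = "2 * z * d" and l = "\<lambda>b. 8 * ((x - y) \<bullet> b)\<^sup>2 - 4 * z"])
    show "((\<lambda>t. (c t - (norm (x - y))\<^sup>2)\<^sup>2) has_real_derivative 2 * z * d) (at t)"
      using assms by (auto intro!: derivative_eq_intros simp: z_def)
    fix b :: 'a assume b: "b \<in> Basis"
    have e: "(c t - (norm (x + s *\<^sub>R b - y))\<^sup>2) = z - 2 * s * ((x - y) \<bullet> b) - s\<^sup>2" for s
      unfolding norm_line[OF b] z_def by simp
    show "second_deriv_at0 (\<lambda>s. (c t - (norm (x + s *\<^sub>R b - y))\<^sup>2)\<^sup>2) (8 * ((x - y) \<bullet> b)\<^sup>2 - 4 * z)"
      unfolding second_deriv_at0_def e
      by (intro exI[of _ "\<lambda>s. 2 * (z - 2 * s * ((x - y) \<bullet> b) - s\<^sup>2) * (- 2 * ((x - y) \<bullet> b) - 2 * s)"]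
           conjI always_eventually allI)
         (auto intro!: derivative_eq_intros simp: power2_eq_square)
  next
    have "(\<Sum>b\<in>Basis. ((x - y) \<bullet> b)\<^sup>2) = (norm (x - y))\<^sup>2"
      unfolding power2_norm_eq_inner euclidean_inner[of "x - y" "x - y"] by (simp add: power2_eq_square)
    then show "2 * (c t - (norm (x - y))\<^sup>2) * d - 8 * (norm (x - y))\<^sup>2
             + 4 * DIM('a) * (c t - (norm (x - y))\<^sup>2)
       = 2 * z * d - (\<Sum>b\<in>Basis. 8 * ((x - y) \<bullet> b)\<^sup>2 - 4 * z)"
      by (simp add: sum_subtractf sum_distrib_left[symmetric] z_def)
  qed
qed

text \<open>\<open>J\<close> itself need not be differentiable: at a negative interior point it is
  enough that a function with a heat operator touches \<open>J\<close> from above. At a minimum of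
  \<open>J\<close> such a function has a minimum too, so the derivative tests apply to it.\<close>

lemma min_principle:
  fixes J :: "'a::euclidean_space \<Rightarrow> real \<Rightarrow> real"
  assumes D: "open D" "bounded D" 
    and cont: "continuous_on (closure D \<times> {t0..t1}) (\<lambda>(x, t). J x t)"
    and init: "\<And>x. x \<in> closure D \<Longrightarrow> 0 \<le> J x t0"
    and lateral: "\<And>x t. x \<in> frontier D \<Longrightarrow> t0 \<le> t \<Longrightarrow> t \<le> t1 \<Longrightarrow> 0 \<le> J x t"
    and touch: "\<And>x t. x \<in> D \<Longrightarrow> t0 < t \<Longrightarrow> t \<le> t1 \<Longrightarrow> J x t < 0 \<Longrightarrow>
       \<exists>\<psi> H. \<psi> x t = J x t \<and> (\<forall>\<^sub>F z in nhds (x, t). J (fst z) (snd z) \<le> \<psi> (fst z) (snd z)) \<and>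
         heat_at \<psi> x t H \<and> M * J x t \<le> H"
    and x: "x \<in> closure D" "t0 \<le> t" "t \<le> t1"
  shows "0 \<le> J x t"
proof (rule ccontr)
  assume neg: "\<not> 0 \<le> J x t"
  \<comment> \<open>The weight exp (- N t) preserves signs. At a negative minimum of the weighted
    function, the time derivative \<open>d\<close> of the touching function is at most N J and its
    Laplacian is nonnegative, while M J is at most \<open>d\<close> minus the Laplacian. With N = M
    + 1 this forces J to be nonnegative.\<close>
  define N where "N = M + 1"
  define W where "W = (\<lambda>z. exp (- N * snd z) * J (fst z) (snd z))"
  have W: "continuous_on (closure D \<times> {t0..t1}) W"
    unfolding W_def using cont by (auto intro!: continuous_intros simp: case_prod_beta)
  have "compact (closure D \<times> {t0..t1})"
    using D by (auto intro!: compact_Times)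
  then obtain z where z: "z \<in> closure D \<times> {t0..t1}"
      and zmin: "\<And>z'. z' \<in> closure D \<times> {t0..t1} \<Longrightarrow> W z \<le> W z'"
    using continuous_attains_inf[OF _ _ W] x by fastforce
  obtain \<xi> \<tau> where zeq: "z = (\<xi>, \<tau>)" by fastforce
  have "W z \<le> W (x, t)" using zmin x by auto
  also have "\<dots> < 0" using neg by (simp add: W_def mult_pos_neg)
  finally have J0: "J \<xi> \<tau> < 0" by (simp add: W_def zeq mult_less_0_iff)
  have "\<tau> \<noteq> t0" using init[of \<xi>] J0 z by (auto simp: zeq)
  then have \<tau>: "t0 < \<tau>" "\<tau> \<le> t1" using z by (auto simp: zeq)
  have "\<xi> \<notin> frontier D" using lateral[of \<xi> \<tau>] J0 \<tau> by auto
  then have \<xi>: "\<xi> \<in> D" using z D by (auto simp: zeq frontier_def interior_open)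
  obtain \<psi> H where \<psi>0: "\<psi> \<xi> \<tau> = J \<xi> \<tau>"
    and \<psi>: "\<forall>\<^sub>F z in nhds (\<xi>, \<tau>). J (fst z) (snd z) \<le> \<psi> (fst z) (snd z)"
    and H: "heat_at \<psi> \<xi> \<tau> H" and HM: "M * J \<xi> \<tau> \<le> H"
    using touch[OF \<xi> \<tau> J0] by blast
  obtain d l where d: "(\<psi> \<xi> has_real_derivative d) (at \<tau>)"
    and l: "\<And>b. b \<in> Basis \<Longrightarrow> second_deriv_at0 (\<lambda>s. \<psi> (\<xi> + s *\<^sub>R b) \<tau>) (l b)"
    and Hdl: "H = d - sum l Basis"
    using H unfolding heat_at_def by blast
  have "\<forall>\<^sub>F z in nhds (\<xi>, \<tau>). z \<in> D \<times> {t0<..}"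
    using D \<xi> \<tau> by (intro eventually_nhds_in_open open_Times) auto
  \<comment> \<open>Only times up to \<tau> are compared, since \<tau> may be the final time
    \<open>t1\<close> and neighbourhoods then leave the cylinder.\<close>
  with \<psi> have ev: "\<forall>\<^sub>F z in nhds (\<xi>, \<tau>). snd z \<le> \<tau> \<longrightarrow> exp (- N * \<tau>) * \<psi> \<xi> \<tau> \<le> exp (- N * snd z) * \<psi> (fst z) (snd z)"
  proof eventually_elim
    case (elim z')
    show ?case
    proof
      assume "snd z' \<le> \<tau>"
      then have "z' \<in> closure D \<times> {t0..t1}"
        using elim \<tau> closure_subset[of D] by (auto simp: mem_Times_iff)
      then have "W z \<le> W z'" by (rule zmin)
      also have "\<dots> \<le> exp (- N * snd z') * \<psi> (fst z') (snd z')"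
        using elim by (simp add: W_def)
      finally show "exp (- N * \<tau>) * \<psi> \<xi> \<tau> \<le> exp (- N * snd z') * \<psi> (fst z') (snd z')"
        by (simp add: W_def zeq \<psi>0)
    qed
  qed
  have "0 \<le> l b" if b: "b \<in> Basis" for b
  proof (rule second_deriv_at0_nonneg_at_min[OF l[OF b]])
    have "((\<lambda>s. (\<xi> + s *\<^sub>R b, \<tau>)) \<longlongrightarrow> (\<xi> + 0 *\<^sub>R b, \<tau>)) (nhds 0)"
      by (intro tendsto_intros filterlim_ident)
    then have "filterlim (\<lambda>s. (\<xi> + s *\<^sub>R b, \<tau>)) (nhds (\<xi>, \<tau>)) (nhds 0)" by simp
    from eventually_compose_filterlim[OF ev this]
    show "\<forall>\<^sub>F s in nhds 0. \<psi> (\<xi> + 0 *\<^sub>R b) \<tau> \<le> \<psi> (\<xi> + s *\<^sub>R b) \<tau>"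
      by simp
  qed
  then have sum: "0 \<le> sum l Basis" by (simp add: sum_nonneg)
  \<comment> \<open>The comparison with earlier times is one-sided, hence an inequality and not a
    vanishing derivative.\<close>
  have "exp (- N * \<tau>) * (d - N * \<psi> \<xi> \<tau>) \<le> 0"
  proof (rule ccontr)
    assume "\<not> exp (- N * \<tau>) * (d - N * \<psi> \<xi> \<tau>) \<le> 0"
    then have pos: "0 < exp (- N * \<tau>) * (d - N * \<psi> \<xi> \<tau>)" by simp
    have "((\<lambda>s. exp (- N * s) * \<psi> \<xi> s) has_real_derivative exp (- N * \<tau>) * (d - N * \<psi> \<xi> \<tau>)) (at \<tau>)"
      using d by (auto intro!: derivative_eq_intros simp: algebra_simps)
    from DERIV_pos_inc_left[OF this pos] obtain e where e: "e > 0"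
      "\<And>h. h > 0 \<Longrightarrow> h < e \<Longrightarrow> exp (- N * (\<tau> - h)) * \<psi> \<xi> (\<tau> - h) < exp (- N * \<tau>) * \<psi> \<xi> \<tau>"
      by blast
    have "((\<lambda>s. (\<xi>, s)) \<longlongrightarrow> (\<xi>, \<tau>)) (nhds \<tau>)"
      by (intro tendsto_intros filterlim_ident)
    from eventually_compose_filterlim[OF ev this]
    obtain e' where e': "e' > 0"
      "\<And>s. dist s \<tau> < e' \<Longrightarrow> s \<le> \<tau> \<Longrightarrow> exp (- N * \<tau>) * \<psi> \<xi> \<tau> \<le> exp (- N * s) * \<psi> \<xi> s"
      unfolding eventually_nhds_metric by auto
    define h where "h = min e e' / 2"
    have "h > 0" "h < e" "h < e'" using e e' by (auto simp: h_def)
    with e(2)[of h] e'(2)[of "\<tau> - h"] show False by (simp add: dist_real_def)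
  qed
  then have "d \<le> N * J \<xi> \<tau>" by (simp add: mult_le_0_iff \<psi>0)
  with sum Hdl HM J0 show False by (simp add: N_def algebra_simps)
qed

section \<open>A lower barrier for supersolutions of the heat equation\<close>

text \<open>The first hypothesis says that the discriminant of \<kappa> z^2 - k z + 8 A is not
  positive. This is what makes the barriers below subsolutions.\<close>

lemma quadratic_bound:
  fixes k \<kappa> A z :: real
  assumes "k\<^sup>2 \<le> 32 * \<kappa> * A" "0 < A"
  shows "k * z \<le> \<kappa> * z\<^sup>2 + 8 * A"
proof -
  have "0 \<le> (k * z - 16 * A)\<^sup>2" by simp
  then have "0 \<le> 32 * A * (\<kappa> * z\<^sup>2 - k * z + 8 * A)"
    using mult_right_mono[OF assms(1), of "z\<^sup>2"]
    by (simp add: power2_eq_square algebra_simps)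
  then show ?thesis using assms(2) by (simp add: zero_le_mult_iff)
qed

text \<open>The barrier is a paraboloid squared on a ball whose squared radius grows at rate \<open>s\<close>;
  being allowed to grow, it carries positivity from a small ball to a large one.\<close>

lemma expanding_ball_lower_bound:
  fixes w :: "'a::euclidean_space \<Rightarrow> real \<Rightarrow> real" and R \<rho> s \<kappa> m :: real
  assumes rad: "0 < \<rho>" "0 < R" "0 \<le> s" "\<rho>\<^sup>2 + s * (t1 - t0) \<le> R\<^sup>2"
    and lam: "0 \<le> \<kappa>" "(2 * s + 4 * DIM('a) + 8)\<^sup>2 \<le> 32 * \<kappa> * \<rho>\<^sup>2"
    and m: "0 \<le> m"
    and cont: "continuous_on (cball y R \<times> {t0..t1}) (\<lambda>(x, t). w x t)"
    and nonneg: "\<And>x t. x \<in> cball y R \<Longrightarrow> t0 \<le> t \<Longrightarrow> t \<le> t1 \<Longrightarrow> 0 \<le> w x t"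
    and super: "\<And>x t. x \<in> ball y R \<Longrightarrow> t0 < t \<Longrightarrow> t \<le> t1 \<Longrightarrow> \<exists>H\<ge>0. heat_at w x t H"
    and init: "\<And>x. x \<in> ball y \<rho> \<Longrightarrow> m * (\<rho>\<^sup>2 - (norm (x - y))\<^sup>2)\<^sup>2 \<le> w x t0"
    and x: "x \<in> cball y R" "t0 \<le> t" "t \<le> t1" "(norm (x - y))\<^sup>2 \<le> \<rho>\<^sup>2 + s * (t - t0)"
  shows "m * exp (- \<kappa> * (t - t0)) * (\<rho>\<^sup>2 + s * (t - t0) - (norm (x - y))\<^sup>2)\<^sup>2 \<le> w x t"
proof -
  define z where "z = (\<lambda>x t. \<rho>\<^sup>2 + s * (t - t0) - (norm (x - y))\<^sup>2)"
  define e where "e = (\<lambda>t. m * exp (- \<kappa> * (t - t0)))"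
  \<comment> \<open>The truncation extends the barrier by zero beyond the expanding ball. Where
    \<open>J\<close> is negative, \<open>z\<close> is positive, also in a neighbourhood, so there
    the truncation is inactive and the untruncated difference can serve as touching
    function.\<close>
  define J where "J = (\<lambda>x t. w x t - e t * (max 0 (z x t))\<^sup>2)"
  have e0: "0 \<le> e t" for t using m by (simp add: e_def)
  have zcont: "continuous_on S (\<lambda>p. z (fst p) (snd p))" for S
    unfolding z_def by (intro continuous_intros)
  have "0 \<le> J x t"
  proof (rule min_principle[where J = J and D = "ball y R" and M = 0 and ?t0.0 = t0 and ?t1.0 = t1])
    show "continuous_on (closure (ball y R) \<times> {t0..t1}) (\<lambda>(x, t). J x t)"
      using cont rad zcont unfolding J_def case_prod_beta e_def
      by (auto intro!: continuous_intros)
  next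
    fix x assume "x \<in> closure (ball y R)"
    then have x: "x \<in> cball y R" using rad by simp
    have lam0: "t0 \<le> t1" using \<open>t0 \<le> t\<close> \<open>t \<le> t1\<close> by simp
    show "0 \<le> J x t0"
    proof (cases "x \<in> ball y \<rho>")
      case True
      then have "(norm (x - y))\<^sup>2 \<le> \<rho>\<^sup>2"
        by (intro power_mono) (auto simp: dist_norm norm_minus_commute)
      with init[OF True] show ?thesis by (simp add: J_def z_def e_def)
    next
      case False
      then have "\<rho>\<^sup>2 \<le> (norm (x - y))\<^sup>2"
        using rad by (intro power_mono) (auto simp: dist_norm norm_minus_commute)
      with nonneg[of x t0] x lam0 show ?thesis by (simp add: J_def z_def)
    qed
  next
    fix x t assume x: "x \<in> frontier (ball y R)" and t: "t0 \<le> t" "t \<le> t1"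
    then have x': "norm (x - y) = R" using rad by (simp add: dist_norm norm_minus_commute)
    have "s * (t - t0) \<le> s * (t1 - t0)" using rad t by (intro mult_left_mono) auto
    then have "z x t \<le> 0" unfolding z_def x' using rad by simp
    then show "0 \<le> J x t" using nonneg[of x t] x' t
      by (simp add: J_def dist_norm norm_minus_commute)
  next
    fix x t assume x: "x \<in> ball y R" and t: "t0 < t" "t \<le> t1" and neg: "J x t < 0"
    have zpos: "0 < z x t"
    proof (rule ccontr)
      assume "\<not> 0 < z x t"
      then have "J x t = w x t" by (simp add: J_def)
      with nonneg[of x t] x t neg show False by simp
    qed
    obtain H where H: "H \<ge> 0" "heat_at w x t H" using super[OF x t] by blast
    define H' where "H' = 2 * z x t * s - 8 * (norm (x - y))\<^sup>2 + 4 * DIM('a) * z x t"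
    define \<psi> where "\<psi> = (\<lambda>x t. 1 * w x t + (- 1) * (e t * (z x t)\<^sup>2))"
    have "heat_at (\<lambda>x t. (z x t)\<^sup>2) x t H'"
      unfolding z_def H'_def by (rule heat_at_quad_square) (auto intro!: derivative_eq_intros)
    moreover have "(e has_real_derivative (- \<kappa> * e t)) (at t)"
      unfolding e_def by (auto intro!: derivative_eq_intros)
    ultimately have hB: "heat_at (\<lambda>x t. e t * (z x t)\<^sup>2) x t (- \<kappa> * e t * (z x t)\<^sup>2 + e t * H')"
      by (rule heat_at_time_mult)
    have h: "heat_at \<psi> x t (1 * H + (- 1) * (- \<kappa> * e t * (z x t)\<^sup>2 + e t * H'))"
      unfolding \<psi>_def by (rule heat_at_lincomb[OF H(2) hB])
    define A where "A = \<rho>\<^sup>2 + s * (t - t0)"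
    \<comment> \<open>Writing |x - y|^2 as A - z turns the heat operator of z^2 into k z - 8 A,
      which \<open>quadratic_bound\<close> estimates by \<kappa> z^2. The decay rate \<kappa> of the
      factor \<open>e\<close> absorbs exactly this.\<close>
    define k where "k = 2 * s + 4 * DIM('a) + 8"
    have A: "\<rho>\<^sup>2 \<le> A" using rad t by (simp add: A_def)
    have "k\<^sup>2 \<le> 32 * \<kappa> * A"
      using lam(2) mult_left_mono[OF A, of "32 * \<kappa>"] lam(1) by (simp add: k_def)
    moreover have "0 < A" using A rad by (meson less_le_trans zero_less_power)
    ultimately have "k * z x t \<le> \<kappa> * (z x t)\<^sup>2 + 8 * A" by (rule quadratic_bound)
    moreover have "H' = k * z x t - 8 * A"
      unfolding H'_def k_def A_def z_def by (simp add: algebra_simps)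
    ultimately have "H' \<le> \<kappa> * (z x t)\<^sup>2" by simp
    then have "e t * H' \<le> e t * (\<kappa> * (z x t)\<^sup>2)" using e0 by (rule mult_left_mono)
    then have "0 \<le> 1 * H + (- 1) * (- \<kappa> * e t * (z x t)\<^sup>2 + e t * H')"
      using H by (simp add: algebra_simps)
    moreover have "\<forall>\<^sub>F p in nhds (x, t). J (fst p) (snd p) \<le> \<psi> (fst p) (snd p)"
    proof -
      have "open ((\<lambda>p. z (fst p) (snd p)) -` {0<..})"
        by (intro open_vimage zcont) auto
      then have "\<forall>\<^sub>F p in nhds (x, t). p \<in> (\<lambda>p. z (fst p) (snd p)) -` {0<..}"
        by (rule eventually_nhds_in_open) (use zpos in auto)
      then show ?thesis by eventually_elim (simp add: J_def \<psi>_def)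
    qed
    ultimately show "\<exists>\<psi> H. \<psi> x t = J x t \<and> (\<forall>\<^sub>F z in nhds (x, t). J (fst z) (snd z) \<le> \<psi> (fst z) (snd z)) \<and>
         heat_at \<psi> x t H \<and> 0 * J x t \<le> H"
      using h zpos by (intro exI[of _ \<psi>] exI conjI) (auto simp: J_def \<psi>_def)
  qed (use x rad in auto)
  moreover have "0 \<le> z x t" using x by (simp add: z_def)
  ultimately show ?thesis by (simp add: J_def e_def z_def)
qed

subsection \<open>Monotonicity in time\<close>

text \<open>Convexity of the negative power. After scaling by \<open>a\<close> it reduces to ln r
  \<le> r - 1 and 1 + v \<le> exp v.\<close>

lemma powr_neg_above_tangent:
  fixes a b p :: real
  assumes "0 < a" "0 < b" "0 \<le> p"
  shows "a powr (- p) - p * a powr (- p - 1) * (b - a) \<le> b powr (- p)"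
proof -
  define r where "r = b / a"
  have r: "0 < r" "b = a * r" using assms by (auto simp: r_def)
  have "1 - p * (r - 1) \<le> 1 + - p * ln r"
    using ln_le_minus_one[OF r(1)] assms(3) by (simp add: mult_left_mono)
  also have "\<dots> \<le> exp (- p * ln r)" by (rule exp_ge_add_one_self)
  also have "\<dots> = r powr (- p)" using r by (simp add: powr_def)
  finally have "a powr (- p) * (1 - p * (r - 1)) \<le> a powr (- p) * r powr (- p)"
    by (intro mult_left_mono) auto
  also have "\<dots> = b powr (- p)" using r assms by (simp add: powr_mult)
  also have "a powr (- p) * (1 - p * (r - 1)) = a powr (- p) - p * a powr (- p - 1) * (b - a)"
    using assms by (simp add: r(2) powr_diff field_simps)
  finally show ?thesis .
qed

text \<open>The function \<open>b powr (p + 1) * y powr (- p)\<close> is jointly convex and positively homogeneous,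
  so each of its tangent planes is a linear minorant; \<open>k\<close> is the slope \<open>b / y\<close> of the ray of contact.\<close>

lemma perspective_powr_above_tangent:
  fixes b y k p :: real
  assumes "0 \<le> b" "0 < y" "0 < k" "0 < p"
  shows "(p + 1) * k powr p * b - p * k powr (p + 1) * y \<le> b powr (p + 1) * y powr (- p)"
proof (cases "b = 0")
  case True
  then show ?thesis using assms by simp
next
  case False
  \<comment> \<open>By homogeneity the claim becomes the Bernoulli inequality (p + 1) r - p \<le> r
    powr (p + 1), with contact at r = 1.\<close>
  define r where "r = b / (k * y)"
  have r: "0 < r" "b = k * y * r" using assms False by (auto simp: r_def)
  have "ln (1 / r) \<le> 1 / r - 1" using r by (intro ln_le_minus_one) simp
  then have "1 + p * (1 - 1 / r) \<le> 1 + p * ln r"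
    using assms r by (simp add: ln_div)
  also have "\<dots> \<le> exp (p * ln r)" by (rule exp_ge_add_one_self)
  also have "\<dots> = r powr p" using r by (simp add: powr_def)
  finally have "r * (1 + p * (1 - 1 / r)) \<le> r * r powr p"
    using r by (intro mult_left_mono) auto
  then have "(p + 1) * r - p \<le> r powr (p + 1)"
    using r by (simp add: powr_add algebra_simps)
  then have "k powr (p + 1) * y * ((p + 1) * r - p) \<le> k powr (p + 1) * y * r powr (p + 1)"
    using assms by (intro mult_left_mono) auto
  also have "\<dots> = b powr (p + 1) * y powr (- p)"
    using r assms by (simp add: powr_mult powr_add powr_minus field_simps)
  also have "k powr (p + 1) * y * ((p + 1) * r - p) = (p + 1) * k powr p * b - p * k powr (p + 1) * y"
    using r assms by (simp add: powr_add algebra_simps)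
  finally show ?thesis .
qed

text \<open>Converts bounds on increments with a constant independent of \<open>h\<close> into
  bounds on the time derivative.\<close>

lemma derivative_ge_of_increments:
  fixes g :: "real \<Rightarrow> real"
  assumes "(g has_real_derivative d) (at t)" "0 < h0"
    and "\<And>h. 0 < h \<Longrightarrow> h < h0 \<Longrightarrow> c * h \<le> g (t + h) - g t"
  shows "c \<le> d"
proof (rule ccontr)
  assume "\<not> c \<le> d"
  then have neg: "d - c < 0" by simp
  have "((\<lambda>s. g s - c * s) has_real_derivative d - c) (at t)"
    using assms(1) by (auto intro!: derivative_eq_intros)
  from DERIV_neg_dec_right[OF this neg] obtain e where e: "e > 0"
    "\<And>h. h > 0 \<Longrightarrow> h < e \<Longrightarrow> g (t + h) - c * (t + h) < g t - c * t" by blast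
  define h where "h = min e h0 / 2"
  have "h > 0" "h < e" "h < h0" using e assms by (auto simp: h_def)
  with e(2)[of h] assms(3)[of h] show False by (simp add: algebra_simps)
qed

section \<open>The solution and its time increments\<close>

text \<open>Working form of a classical solution with real \<open>T\<close>: the equation is stated
  through \<open>heat_at\<close>, the lateral condition includes time 0, and the initial condition
  includes the boundary.\<close>

locale mems_solution =
  fixes \<Omega> :: "'a::euclidean_space set" and f :: "'a \<Rightarrow> real" and u :: "'a \<Rightarrow> real \<Rightarrow> real"
    and p T :: real
  assumes open_dom: "open \<Omega>" and connected_dom: "connected \<Omega>" and bounded_dom: "bounded \<Omega>"
    and p_pos: "0 < p" and T_pos: "0 < T"
    and f_cont: "continuous_on (closure \<Omega>) f" and f_nonneg: "\<And>x. x \<in> closure \<Omega> \<Longrightarrow> 0 \<le> f x"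
    and f_nonzero: "\<exists>x\<in>closure \<Omega>. f x \<noteq> 0"
    and u_cont: "continuous_on (closure \<Omega> \<times> {0..<T}) (\<lambda>(x, t). u x t)"
    and u_less_1: "\<And>x t. x \<in> closure \<Omega> \<Longrightarrow> 0 \<le> t \<Longrightarrow> t < T \<Longrightarrow> u x t < 1"
    and u_deriv: "\<And>x t. x \<in> \<Omega> \<Longrightarrow> 0 < t \<Longrightarrow> t < T \<Longrightarrow>
        (u x has_real_derivative deriv (u x) t) (at t)"
    and ut_cont: "continuous_on (\<Omega> \<times> {0<..<T}) (\<lambda>(x, t). deriv (u x) t)"
    and pde: "\<And>x t. x \<in> \<Omega> \<Longrightarrow> 0 < t \<Longrightarrow> t < T \<Longrightarrow> heat_at u x t (f x * (1 - u x t) powr (- p))"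
    and lateral: "\<And>x t. x \<in> frontier \<Omega> \<Longrightarrow> 0 \<le> t \<Longrightarrow> t < T \<Longrightarrow> u x t = 0"
    and initial: "\<And>x. x \<in> closure \<Omega> \<Longrightarrow> u x 0 = 0"
begin

lemma in_closure: "x \<in> \<Omega> \<Longrightarrow> x \<in> closure \<Omega>"
  using closure_subset by blast

lemma u_cont_compose [continuous_intros]:
  assumes "continuous_on S g" "continuous_on S k"
    and "\<And>s. s \<in> S \<Longrightarrow> g s \<in> closure \<Omega> \<and> 0 \<le> k s \<and> k s < T"
  shows "continuous_on S (\<lambda>s. u (g s) (k s))"
proof -
  have "continuous_on S (\<lambda>s. case (g s, k s) of (x, t) \<Rightarrow> u x t)"
    by (rule continuous_on_compose2[OF u_cont]) (use assms in \<open>auto intro!: continuous_intros\<close>)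
  then show ?thesis by simp
qed

lemma f_cont_compose [continuous_intros]:
  "continuous_on S g \<Longrightarrow> (\<And>s. s \<in> S \<Longrightarrow> g s \<in> closure \<Omega>) \<Longrightarrow> continuous_on S (\<lambda>s. f (g s))"
  by (rule continuous_on_compose2[OF f_cont]) auto

lemma compact_cylinder: "compact (closure \<Omega> \<times> {a..b::real})"
  using bounded_dom by (auto intro!: compact_Times)

lemma u_nonneg:
  assumes "x \<in> closure \<Omega>" "0 \<le> t" "t < T"
  shows "0 \<le> u x t"
proof (rule min_principle[where J = u and D = \<Omega> and M = 0 and ?t0.0 = 0 and ?t1.0 = t])
  show "continuous_on (closure \<Omega> \<times> {0..t}) (\<lambda>(x, t). u x t)"
    using assms by (intro continuous_on_subset[OF u_cont]) auto
  fix x s assume "x \<in> \<Omega>" "0 < s" "s \<le> t"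
  then show "\<exists>\<psi> H. \<psi> x s = u x s \<and> (\<forall>\<^sub>F z in nhds (x, s). u (fst z) (snd z) \<le> \<psi> (fst z) (snd z)) \<and>
         heat_at \<psi> x s H \<and> 0 * u x s \<le> H"
    using pde[of x s] f_nonneg[OF in_closure, of x] assms
    by (intro exI[of _ u] exI[of _ "f x * (1 - u x s) powr (- p)"]) auto
qed (use assms open_dom bounded_dom lateral initial in auto)

text \<open>The zeroth-order coefficient of the equation linearized at \<open>u\<close>: the
  derivative of f(x) (1 - v) powr (- p) with respect to v at v = u(x, t).\<close>

definition potential :: "'a \<Rightarrow> real \<Rightarrow> real" where
  "potential x t = f x * (p * (1 - u x t) powr (- p - 1))"

text \<open>Up to a time before \<open>T\<close>, compactness keeps \<open>u\<close> away from 1.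
  The bound supplies the constant \<open>M\<close> of \<open>min_principle\<close>.\<close>

lemma potential_bounded:
  assumes "t1 < T"
  obtains M where "\<And>x t. x \<in> closure \<Omega> \<Longrightarrow> 0 \<le> t \<Longrightarrow> t \<le> t1 \<Longrightarrow> potential x t \<le> M"
proof -
  have "continuous_on (closure \<Omega> \<times> {0..t1}) (\<lambda>z. potential (fst z) (snd z))"
    unfolding potential_def
    using assms u_less_1 by (intro continuous_intros) (auto simp: less_imp_neq)
  then have "compact ((\<lambda>z. potential (fst z) (snd z)) ` (closure \<Omega> \<times> {0..t1}))"
    by (rule compact_continuous_image[OF _ compact_cylinder])
  then obtain M where M: "\<And>v. v \<in> (\<lambda>z. potential (fst z) (snd z)) ` (closure \<Omega> \<times> {0..t1}) \<Longrightarrow> \<bar>v\<bar> \<le> M"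
    using compact_imp_bounded bounded_iff by (metis real_norm_def)
  have "potential x t \<le> M" if "x \<in> closure \<Omega>" "0 \<le> t" "t \<le> t1" for x t
  proof -
    have "(x, t) \<in> closure \<Omega> \<times> {0..t1}" using that by simp
    from M[OF imageI[OF this]] show ?thesis by simp
  qed
  then show thesis by (rule that)
qed

text \<open>The tangent inequality at time \<open>t\<close> bounds the difference of the two source
  terms from below by slope times increment, whatever the sign of the increment.\<close>

lemma heat_increment:
  assumes "x \<in> \<Omega>" "0 < t" "0 < h" "t + h < T"
  obtains H where "heat_at (\<lambda>x t. u x (t + h) - u x t) x t H"
    "potential x t * (u x (t + h) - u x t) \<le> H"
proof
  let ?g = "\<lambda>t. (1 - u x t) powr (- p)"
  have "heat_at (\<lambda>x t. u x (t + h)) x t (f x * ?g (t + h))"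
    by (rule heat_at_time_shift) (use assms pde in auto)
  from heat_at_lincomb[OF this pde[OF assms(1,2)], of 1 "-1"]
  show "heat_at (\<lambda>x t. u x (t + h) - u x t) x t (f x * (?g (t + h) - ?g t))"
    using assms by (simp add: algebra_simps)
  have "?g t - p * (1 - u x t) powr (- p - 1) * ((1 - u x (t + h)) - (1 - u x t)) \<le> ?g (t + h)"
    using assms u_less_1[OF in_closure[OF assms(1)]] p_pos by (intro powr_neg_above_tangent) auto
  then have "f x * (p * (1 - u x t) powr (- p - 1) * (u x (t + h) - u x t)) \<le> f x * (?g (t + h) - ?g t)"
    using f_nonneg[OF in_closure[OF assms(1)]] by (intro mult_left_mono) (auto simp: algebra_simps)
  then show "potential x t * (u x (t + h) - u x t) \<le> f x * (?g (t + h) - ?g t)"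
    by (simp add: potential_def mult.assoc)
qed

lemma increment_cont:
  assumes "0 \<le> t0" "0 < h" "t1 + h < T" "D \<subseteq> closure \<Omega>"
  shows "continuous_on (D \<times> {t0..t1}) (\<lambda>(x, t). u x (t + h) - u x t)"
  unfolding case_prod_beta using assms by (intro continuous_intros) auto

lemma increment_nonneg:
  assumes "x \<in> closure \<Omega>" "0 \<le> t" "0 < h" "t + h < T"
  shows "0 \<le> u x (t + h) - u x t"
proof -
  obtain M where M: "\<And>x s. x \<in> closure \<Omega> \<Longrightarrow> 0 \<le> s \<Longrightarrow> s \<le> t \<Longrightarrow> potential x s \<le> M"
    using potential_bounded[of t] assms by auto
  show ?thesis
  proof (rule min_principle[where J = "\<lambda>x t. u x (t + h) - u x t" and D = \<Omega> and M = M
        and ?t0.0 = 0 and ?t1.0 = t])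
    show "continuous_on (closure \<Omega> \<times> {0..t}) (\<lambda>(x, t). u x (t + h) - u x t)"
      using assms by (intro increment_cont) auto
    show "0 \<le> u x (0 + h) - u x 0" if "x \<in> closure \<Omega>" for x
      using u_nonneg[OF that, of h] initial[OF that] assms by simp
    fix x s assume x: "x \<in> \<Omega>" and s: "0 < s" "s \<le> t" and neg: "u x (s + h) - u x s < 0"
    obtain H where H: "heat_at (\<lambda>x t. u x (t + h) - u x t) x s H"
        "potential x s * (u x (s + h) - u x s) \<le> H"
      using heat_increment[OF x s(1) assms(3)] s assms by auto
    \<comment> \<open>The increment is negative here, so an upper bound on the potential gives a
      lower bound on the product.\<close>
    have "M * (u x (s + h) - u x s) \<le> potential x s * (u x (s + h) - u x s)"
      using neg M[OF in_closure[OF x], of s] s by (intro mult_right_mono_neg) auto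
    then show "\<exists>\<psi> H. \<psi> x s = u x (s + h) - u x s \<and>
        (\<forall>\<^sub>F z in nhds (x, s). u (fst z) (snd z + h) - u (fst z) (snd z) \<le> \<psi> (fst z) (snd z)) \<and>
         heat_at \<psi> x s H \<and> M * (u x (s + h) - u x s) \<le> H"
      using H by (intro exI[of _ "\<lambda>x t. u x (t + h) - u x t"] exI[of _ H]) auto
  qed (use assms open_dom bounded_dom lateral in auto)
qed

lemma potential_nonneg:
  assumes "x \<in> closure \<Omega>"
  shows "0 \<le> potential x t"
  unfolding potential_def using p_pos f_nonneg[OF assms] by simp

section \<open>Strict positivity of the time derivative\<close>

text \<open>A paraboloid growing linearly in time is a subsolution where the source is at least
  \<mu>. This starts the positivity argument at time 0, where no time derivative of \<open>u\<close>
  is available.\<close>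

lemma initial_growth:
  assumes "cball x1 R \<subseteq> \<Omega>" "0 < R" "0 < \<mu>" and f: "\<And>x. x \<in> ball x1 R \<Longrightarrow> \<mu> \<le> f x"
  obtains c where "0 < c"
    "\<And>x t. x \<in> cball x1 R \<Longrightarrow> 0 \<le> t \<Longrightarrow> t < T \<Longrightarrow> c * t * (R\<^sup>2 - (norm (x - x1))\<^sup>2) \<le> u x t"
proof
  define z where "z = (\<lambda>x. R\<^sup>2 - (norm (x - x1))\<^sup>2)"
  define n where "n = real (2 * DIM('a))"
  have n: "0 \<le> n" by (simp add: n_def)
  \<comment> \<open>The heat operator of the comparison function is at most
    \<open>c * (R\<^sup>2 + T * n)\<close>, and the source is at least \<mu> because 0 \<le> u <
    1.\<close>
  define c where "c = \<mu> / (R\<^sup>2 + T * n)"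
  have den: "0 < R\<^sup>2 + T * n" using assms T_pos n by (simp add: add_pos_nonneg)
  then show c: "0 < c" using assms by (simp add: c_def)
  have ccl: "cball x1 R \<subseteq> closure \<Omega>" using assms closure_subset by blast
  fix x t assume x: "x \<in> cball x1 R" and t: "0 \<le> t" "t < T"
  have "0 \<le> u x t - c * t * z x"
  proof (rule min_principle[where J = "\<lambda>x t. u x t - c * t * z x" and D = "ball x1 R" and M = 0
        and ?t0.0 = 0 and ?t1.0 = t])
    show "continuous_on (closure (ball x1 R) \<times> {0..t}) (\<lambda>(x, t). u x t - c * t * z x)"
      unfolding case_prod_beta z_def using assms t ccl by (intro continuous_intros) auto
  next
    fix x s assume "x \<in> frontier (ball x1 R)" and s: "0 \<le> s" "s \<le> t"
    then have x: "norm (x - x1) = R" using assms by (simp add: dist_norm norm_minus_commute)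
    then have "x \<in> closure \<Omega>" using ccl by (auto simp: dist_norm norm_minus_commute)
    then show "0 \<le> u x s - c * s * z x" using u_nonneg[of x s] x s t by (simp add: z_def)
  next
    fix x s assume x: "x \<in> ball x1 R" and s: "0 < s" "s \<le> t"
    have x': "x \<in> \<Omega>" using x assms by auto
    have "heat_at (\<lambda>x t. (c * t) * z x) x s (c * z x + c * s * n)"
      unfolding n_def z_def
      by (rule heat_at_time_mult[OF heat_at_quad]) (auto intro!: derivative_eq_intros)
    from heat_at_lincomb[OF pde[OF x' s(1)] this, of 1 "-1"]
    have h: "heat_at (\<lambda>x t. u x t - c * t * z x) x s
       (f x * (1 - u x s) powr (- p) - (c * z x + c * s * n))"
      using s t by (simp add: algebra_simps)
    have u: "0 \<le> u x s" "u x s < 1"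
      using u_nonneg[of x s] u_less_1[of x s] in_closure[OF x'] s t by auto
    have "1 \<le> (1 - u x s) powr (- p)"
      using u p_pos powr_le1[of p "1 - u x s"] by (simp add: powr_minus one_le_inverse)
    then have "\<mu> \<le> f x * (1 - u x s) powr (- p)"
      using f[OF x] assms(3) mult_mono[of \<mu> "f x" 1 "(1 - u x s) powr (- p)"] by simp
    moreover have "c * z x + c * s * n \<le> c * R\<^sup>2 + c * T * n"
      using c s t n by (intro add_mono mult_left_mono mult_right_mono) (auto simp: z_def)
    moreover have "c * (R\<^sup>2 + T * n) = \<mu>"
      using den by (simp add: c_def)
    then have "c * R\<^sup>2 + c * T * n = \<mu>" by (simp add: algebra_simps)
    ultimately have "0 * (u x s - c * s * z x) \<le> f x * (1 - u x s) powr (- p) - (c * z x + c * s * n)"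
      by simp
    with h show "\<exists>\<psi> H. \<psi> x s = u x s - c * s * z x \<and>
        (\<forall>\<^sub>F w in nhds (x, s). u (fst w) (snd w) - c * snd w * z (fst w) \<le> \<psi> (fst w) (snd w)) \<and>
         heat_at \<psi> x s H \<and> 0 * (u x s - c * s * z x) \<le> H"
      by (intro exI[of _ "\<lambda>x t. u x t - c * t * z x"] exI conjI) auto
  next
    fix x assume "x \<in> closure (ball x1 R)"
    then show "0 \<le> u x 0 - c * 0 * z x" using initial[of x] ccl assms by auto
  qed (use x t assms in auto)
  then show "c * t * (R\<^sup>2 - (norm (x - x1))\<^sup>2) \<le> u x t" by (simp add: z_def)
qed

text \<open>Increments are supersolutions of the heat equation, so the expanding barrier carries
  their lower bound from the small ball to the large one. The resulting factor of \<open>h\<close>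
  does not depend on \<open>h\<close>. Assuming increments instead of a derivative at
  \<open>t0\<close> admits t0 = 0.\<close>

lemma ut_pos_spread:
  assumes t: "0 \<le> t0" "t0 < t1" "t1 < T" and ball: "cball y R \<subseteq> \<Omega>" "0 < \<rho>" "\<rho> \<le> R"
    and c: "0 < c" "0 < h0"
      "\<And>x h. x \<in> ball y \<rho> \<Longrightarrow> 0 < h \<Longrightarrow> h < h0 \<Longrightarrow> c * h \<le> u x (t0 + h) - u x t0"
    and x: "x \<in> ball y R"
  shows "0 < deriv (u x) t1"
proof -
  \<comment> \<open>The squared radius grows from \<open>\<rho>\<^sup>2\<close> to exactly
    \<open>R\<^sup>2\<close> during the available time; \<kappa> gives equality in the decay
    condition; with \<open>m\<close> the initial barrier is at most \<open>c * h\<close>.\<close>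
  define s where "s = (R\<^sup>2 - \<rho>\<^sup>2) / (t1 - t0)"
  define \<kappa> where "\<kappa> = (2 * s + 4 * DIM('a) + 8)\<^sup>2 / (32 * \<rho>\<^sup>2)"
  define m where "m = c / (\<rho>\<^sup>2)\<^sup>2"
  define C where "C = m * exp (- \<kappa> * (t1 - t0)) * (R\<^sup>2 - (norm (x - y))\<^sup>2)\<^sup>2"
  have s: "0 \<le> s" "s * (t1 - t0) = R\<^sup>2 - \<rho>\<^sup>2"
    using t ball by (auto simp: s_def power_mono)
  have m: "0 < m" using c ball by (simp add: m_def)
  have xR: "(norm (x - y))\<^sup>2 < R\<^sup>2"
    using x by (intro power_strict_mono) (auto simp: dist_norm norm_minus_commute)
  have "C \<le> deriv (u x) t1"
  proof (rule derivative_ge_of_increments[where t = t1 and ?h0.0 = "min h0 (T - t1)"])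
    show "(u x has_real_derivative deriv (u x) t1) (at t1)"
      using x ball t by (intro u_deriv) auto
    show "0 < min h0 (T - t1)" using c t by simp
    fix h assume h: "0 < h" "h < min h0 (T - t1)"
    have "(m * h) * exp (- \<kappa> * (t1 - t0)) * (\<rho>\<^sup>2 + s * (t1 - t0) - (norm (x - y))\<^sup>2)\<^sup>2 \<le> u x (t1 + h) - u x t1"
    proof (rule expanding_ball_lower_bound[where w = "\<lambda>x t. u x (t + h) - u x t" and y = y and R = R
          and ?t0.0 = t0 and ?t1.0 = t1])
      show "continuous_on (cball y R \<times> {t0..t1}) (\<lambda>(x, t). u x (t + h) - u x t)"
        using t h ball closure_subset[of \<Omega>] by (intro increment_cont) auto
      show "0 \<le> u x (s + h) - u x s" if "x \<in> cball y R" "t0 \<le> s" "s \<le> t1" for x s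
        using that t h ball in_closure by (intro increment_nonneg) auto
      show "\<exists>H\<ge>0. heat_at (\<lambda>x t. u x (t + h) - u x t) x s H" 
        if "x \<in> ball y R" "t0 < s" "s \<le> t1" for x s
      proof -
        have x: "x \<in> \<Omega>" and s: "0 < s" "s + h < T" using that ball t h by auto
        obtain H where H: "heat_at (\<lambda>x t. u x (t + h) - u x t) x s H"
            "potential x s * (u x (s + h) - u x s) \<le> H"
          using heat_increment[OF x s(1) h(1) s(2)] by blast
        moreover have "0 \<le> potential x s * (u x (s + h) - u x s)"
          using that t h x in_closure
          by (intro mult_nonneg_nonneg potential_nonneg increment_nonneg) auto
        ultimately show ?thesis by (intro exI[of _ H]) auto
      qed
      show "m * h * (\<rho>\<^sup>2 - (norm (x - y))\<^sup>2)\<^sup>2 \<le> u x (t0 + h) - u x t0" if "x \<in> ball y \<rho>" for x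
      proof -
        have "(norm (x - y))\<^sup>2 \<le> \<rho>\<^sup>2"
          using that by (intro power_mono) (auto simp: dist_norm norm_minus_commute)
        then have "(\<rho>\<^sup>2 - (norm (x - y))\<^sup>2)\<^sup>2 \<le> (\<rho>\<^sup>2)\<^sup>2" by (intro power_mono) auto
        then have "m * h * (\<rho>\<^sup>2 - (norm (x - y))\<^sup>2)\<^sup>2 \<le> m * h * (\<rho>\<^sup>2)\<^sup>2"
          using m h by (intro mult_left_mono) auto
        also have "\<dots> = c * h" using ball by (simp add: m_def)
        also have "\<dots> \<le> u x (t0 + h) - u x t0" using c(3)[OF that] h by simp
        finally show ?thesis .
      qed
    qed (use s xR x ball t m h in \<open>auto simp: \<kappa>_def dist_norm norm_minus_commute\<close>)
    then show "C * h \<le> u x (t1 + h) - u x t1" using s by (simp add: C_def mult_ac)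
  qed
  moreover have "0 < C" using m xR by (simp add: C_def)
  ultimately show ?thesis by simp
qed

text \<open>The time derivative has a positive minimum on the compact cylinder, and the mean value
  theorem transfers it to increments.\<close>

lemma uniform_increment:
  assumes K: "compact K" "K \<subseteq> \<Omega>" and t: "0 < t0" "t0 < t1" "t1 < T"
    and pos: "\<And>x t. x \<in> K \<Longrightarrow> t0 \<le> t \<Longrightarrow> t \<le> t1 \<Longrightarrow> 0 < deriv (u x) t"
  obtains c where "0 < c"
    "\<And>x h. x \<in> K \<Longrightarrow> 0 < h \<Longrightarrow> h \<le> t1 - t0 \<Longrightarrow> c * h \<le> u x (t0 + h) - u x t0"
proof (cases "K = {}")
  case True
  then show thesis using that[of 1] by simp
next
  case False
  have "continuous_on (K \<times> {t0..t1}) (\<lambda>(x, t). deriv (u x) t)"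
    using K t by (intro continuous_on_subset[OF ut_cont]) auto
  moreover have "compact (K \<times> {t0..t1})" using K by (intro compact_Times) auto
  moreover have "K \<times> {t0..t1} \<noteq> {}" using False t by simp
  ultimately obtain q where q: "q \<in> K \<times> {t0..t1}"
    "\<And>q'. q' \<in> K \<times> {t0..t1} \<Longrightarrow> (case q of (x, t) \<Rightarrow> deriv (u x) t) \<le> (case q' of (x, t) \<Rightarrow> deriv (u x) t)"
    using continuous_attains_inf by meson
  define c where "c = (case q of (x, t) \<Rightarrow> deriv (u x) t)"
  have "c * h \<le> u x (t0 + h) - u x t0" if "x \<in> K" "0 < h" "h \<le> t1 - t0" for x h
  proof -
    have "\<exists>s>t0. s < t0 + h \<and> u x (t0 + h) - u x t0 = (t0 + h - t0) * deriv (u x) s"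
      using that K t by (intro MVT2 u_deriv) auto
    then obtain s where s: "t0 < s" "s < t0 + h" "u x (t0 + h) - u x t0 = h * deriv (u x) s"
      by auto
    have "c \<le> deriv (u x) s" using q(2)[of "(x, s)"] that s by (auto simp: c_def)
    then show ?thesis using s that by (simp add: mult.commute)
  qed
  moreover have "0 < c" using q(1) pos by (auto simp: c_def)
  ultimately show thesis using that by blast
qed

text \<open>Continuity of the time derivative first gives positivity on a small cylinder around
  \<open>(y, t0)\<close>, which \<open>uniform_increment\<close> turns into the hypothesis of
  \<open>ut_pos_spread\<close>.\<close>

lemma ut_pos_spread_from_point:
  assumes y: "cball y R \<subseteq> \<Omega>" "0 < R" and t: "0 < t0" "t0 < t1" "t1 < T"
    and pos: "0 < deriv (u y) t0" and x: "x \<in> ball y R"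
  shows "0 < deriv (u x) t1"
proof -
  have "continuous_on (\<Omega> \<times> {0<..<T}) (\<lambda>z. deriv (u (fst z)) (snd z))"
    using ut_cont by (simp add: case_prod_beta)
  moreover have "open (\<Omega> \<times> {0<..<T})" using open_dom by (intro open_Times) auto
  moreover have y': "(y, t0) \<in> \<Omega> \<times> {0<..<T}" using y t by (auto simp: subset_iff)
  ultimately have "isCont (\<lambda>z. deriv (u (fst z)) (snd z)) (y, t0)"
    using continuous_on_eq_continuous_at by blast
  then have "((\<lambda>z. deriv (u (fst z)) (snd z)) \<longlongrightarrow> deriv (u y) t0) (nhds (y, t0))"
    using tendsto_at_iff_tendsto_nhds[of "\<lambda>z. deriv (u (fst z)) (snd z)" "(y, t0)"]
    by (simp add: isCont_def)
  from order_tendstoD(1)[OF this pos]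
  have "\<forall>\<^sub>F z in nhds (y, t0). 0 < deriv (u (fst z)) (snd z)" .
  then obtain \<delta> where \<delta>: "\<delta> > 0"
    "\<And>z. dist z (y, t0) < \<delta> \<Longrightarrow> 0 < deriv (u (fst z)) (snd z)"
    unfolding eventually_nhds_metric by blast
  define \<rho> where "\<rho> = min (\<delta> / 3) R"
  define t2 where "t2 = min (t0 + \<delta> / 3) ((t0 + T) / 2)"
  have \<rho>: "0 < \<rho>" "\<rho> \<le> R" "\<rho> \<le> \<delta> / 3" and t2: "t0 < t2" "t2 < T" "t2 \<le> t0 + \<delta> / 3"
    using \<delta> y t by (auto simp: \<rho>_def t2_def min_less_iff_disj)
  have "0 < deriv (u x) s" if "x \<in> cball y \<rho>" "t0 \<le> s" "s \<le> t2" for x s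
  proof -
    have "dist (x, s) (y, t0) \<le> dist x y + dist s t0"
      by (simp add: dist_prod_def sqrt_sum_squares_le_sum)
    also have "\<dots> < \<delta>" using that \<rho> t2 \<delta>(1) by (simp add: dist_commute dist_real_def)
    finally show ?thesis using \<delta>(2)[of "(x, s)"] by simp
  qed
  moreover have "cball y \<rho> \<subseteq> \<Omega>" using \<rho> y by (auto simp: subset_iff)
  ultimately obtain c where "0 < c"
    "\<And>x h. x \<in> cball y \<rho> \<Longrightarrow> 0 < h \<Longrightarrow> h \<le> t2 - t0 \<Longrightarrow> c * h \<le> u x (t0 + h) - u x t0"
    using uniform_increment[OF compact_cball _ t(1) t2(1,2)] by blast
  then show ?thesis
    using ut_pos_spread[of t0 t1 y R \<rho> c "t2 - t0" x] t t2 y \<rho> x by auto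
qed

text \<open>The points whose time derivative is positive at all times form a nonempty, relatively
  open and closed subset of the connected domain.\<close>

lemma ut_pos:
  assumes "x \<in> \<Omega>" "0 < t" "t < T"
  shows "0 < deriv (u x) t"
proof -
  define G where "G = {y \<in> \<Omega>. \<forall>t. 0 < t \<and> t < T \<longrightarrow> 0 < deriv (u y) t}"
  have spread: "x \<in> G" if y: "y \<in> G" "cball y R \<subseteq> \<Omega>" "0 < R" and x: "x \<in> ball y R" for x y R
  proof -
    have "0 < deriv (u x) t" if t: "0 < t" "t < T" for t
      \<comment> \<open>Spreading needs a strictly earlier time. Membership in \<open>G\<close>
        covers all positive times, so t / 2 is always available.\<close>
      by (rule ut_pos_spread_from_point[where ?t0.0 = "t / 2" and y = y and R = R])
         (use y x t in \<open>auto simp: G_def\<close>)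
    then show ?thesis using x y by (auto simp: G_def subset_iff)
  qed
  have "\<exists>r>0. ball y r \<subseteq> G" if y: "y \<in> G" for y
  proof -
    have "y \<in> \<Omega>" using y by (simp add: G_def)
    then obtain R where "R > 0" "cball y R \<subseteq> \<Omega>" using open_dom open_contains_cball by blast
    then show ?thesis using spread[OF y] by blast
  qed
  then have openG: "open G" by (auto simp: open_contains_ball)
  have "\<exists>r>0. ball y r \<subseteq> \<Omega> - G" if y: "y \<in> \<Omega> - G" for y
  proof -
    obtain R where R: "R > 0" "cball y R \<subseteq> \<Omega>" using y open_dom open_contains_cball by blast
    \<comment> \<open>Halving the radius makes the relation symmetric: the ball of radius R / 2
      about \<open>x\<close> contains \<open>y\<close> and stays in the domain, so positivity at
      \<open>x\<close> would spread back to \<open>y\<close>.\<close>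
    have "x \<notin> G" if x: "x \<in> ball y (R / 2)" for x
    proof
      assume "x \<in> G"
      moreover have "cball x (R / 2) \<subseteq> cball y R"
      proof
        fix z assume "z \<in> cball x (R / 2)"
        then show "z \<in> cball y R" using x dist_triangle[of y z x] by simp
      qed
      ultimately have "y \<in> G" using x R by (intro spread[of x "R / 2" y]) (auto simp: dist_commute)
      then show False using y by simp
    qed
    moreover have "ball y (R / 2) \<subseteq> \<Omega>" using R by (auto simp: subset_iff)
    ultimately show ?thesis using R by (intro exI[of _ "R / 2"]) auto
  qed
  then have "open (\<Omega> - G)" by (auto simp: open_contains_ball)
  moreover have "G \<noteq> {}"
  proof -
    obtain x1 where x1: "x1 \<in> \<Omega>" "f x1 > 0"
    proof (rule ccontr)
      assume "\<not> thesis"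
      then have z: "\<And>x. x \<in> \<Omega> \<Longrightarrow> f x = 0" using that f_nonneg in_closure by (metis less_eq_real_def)
      have "f x = 0" if "x \<in> closure \<Omega>" for x
        using continuous_constant_on_closure[OF f_cont, of 0] z that by auto
      then show False using f_nonzero by auto
    qed
    have "isCont f x1"
      using f_cont x1 open_dom closure_subset
      by (meson continuous_on_subset continuous_on_eq_continuous_at)
    then have "(f \<longlongrightarrow> f x1) (nhds x1)"
      by (simp add: isCont_def tendsto_at_iff_tendsto_nhds)
    from order_tendstoD(1)[OF this, of "f x1 / 2"]
    have "\<forall>\<^sub>F x in nhds x1. f x1 / 2 < f x" using x1 by simp
    then have "\<forall>\<^sub>F x in nhds x1. f x1 / 2 < f x \<and> x \<in> \<Omega>"
      using x1 open_dom by (auto intro: eventually_conj eventually_nhds_in_open)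
    then obtain d where d: "d > 0" "\<And>x. dist x x1 < d \<Longrightarrow> f x1 / 2 < f x \<and> x \<in> \<Omega>"
      unfolding eventually_nhds_metric by blast
    define R where "R = d / 2"
    have R: "0 < R" "cball x1 R \<subseteq> \<Omega>" "\<And>x. x \<in> ball x1 R \<Longrightarrow> f x1 / 2 \<le> f x"
      using d by (auto simp: R_def dist_commute subset_iff less_imp_le)
    obtain c where c: "0 < c" 
      "\<And>x t. x \<in> cball x1 R \<Longrightarrow> 0 \<le> t \<Longrightarrow> t < T \<Longrightarrow> c * t * (R\<^sup>2 - (norm (x - x1))\<^sup>2) \<le> u x t"
      using initial_growth[OF R(2) R(1) _ R(3)] x1 by auto
    have "0 < deriv (u x1) t" if t: "0 < t" "t < T" for t
    \<comment> \<open>Since \<open>u\<close> vanishes at time 0, its values are increments from time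
      0, and on the half ball the growth estimate bounds them linearly in \<open>h\<close>.\<close>
    proof (rule ut_pos_spread[where ?t0.0 = 0 and y = x1 and R = R and \<rho> = "R / 2"
          and c = "c * (R\<^sup>2 - (R / 2)\<^sup>2)" and ?h0.0 = T])
      show "0 < c * (R\<^sup>2 - (R / 2)\<^sup>2)" using c R by (simp add: power2_eq_square)
      fix x h assume x: "x \<in> ball x1 (R / 2)" and h: "0 < h" "h < T"
      have "(norm (x - x1))\<^sup>2 \<le> (R / 2)\<^sup>2"
        using x by (intro power_mono) (auto simp: dist_norm norm_minus_commute)
      then have "c * (R\<^sup>2 - (R / 2)\<^sup>2) * h \<le> c * h * (R\<^sup>2 - (norm (x - x1))\<^sup>2)"
        using c h by (simp add: mult_left_mono mult.commute mult.left_commute)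
      also have "\<dots> \<le> u x (0 + h) - u x 0"
        using c(2)[of x h] initial[of x] x h R in_closure by (auto simp: subset_iff)
      finally show "c * (R\<^sup>2 - (R / 2)\<^sup>2) * h \<le> u x (0 + h) - u x 0" .
    qed (use t R T_pos in auto)
    then show ?thesis using x1 by (auto simp: G_def)
  qed
  ultimately have "\<Omega> - G = {}"
    using connectedD[OF connected_dom openG] by (auto simp: G_def)
  then show ?thesis using assms by (auto simp: G_def)
qed

subsection \<open>Rate of approach to one and localization\<close>

text \<open>The increment is compared with a small multiple of \<open>A\<close>. At a negative point
  of the difference, \<open>A\<close> is replaced by a tangent plane in \<beta> and 1 - u, whose
  heat operator follows from those of \<beta> and \<open>u\<close> alone.\<close>

lemma ut_lower_bound:
  assumes ball: "cball x0 R \<subseteq> \<Omega>" "0 < R" and t0: "0 < t0" "t0 < T"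
  obtains \<epsilon> where "0 < \<epsilon>"
    "\<And>x t. x \<in> cball x0 (R / 2) \<Longrightarrow> t0 \<le> t \<Longrightarrow> t < T \<Longrightarrow>
        \<epsilon> * (1 - u x t) powr (- p) \<le> deriv (u x) t"
proof -
  define \<beta> where "\<beta> = (\<lambda>x. (R\<^sup>2 - (norm (x - x0))\<^sup>2)\<^sup>2)"
  define A where "A = (\<lambda>x t. \<beta> x powr (p + 1) * (1 - u x t) powr (- p))"
  define k where "k = 4 * real (DIM('a)) + 8"
  define \<kappa> where "\<kappa> = k\<^sup>2 / (32 * R\<^sup>2)"
  have \<kappa>: "k\<^sup>2 \<le> 32 * \<kappa> * R\<^sup>2" "0 \<le> \<kappa>" using ball by (auto simp: \<kappa>_def)
  \<comment> \<open>\<open>K\<close> is minus the Laplacian of \<beta>. Its bound by \<kappa>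
    \<beta> again comes from the discriminant condition.\<close>
  define K where "K = (\<lambda>x. - 8 * (norm (x - x0))\<^sup>2 + 4 * DIM('a) * (R\<^sup>2 - (norm (x - x0))\<^sup>2))"
  have K: "K x \<le> \<kappa> * \<beta> x" for x
  proof -
    have "K x = k * (R\<^sup>2 - (norm (x - x0))\<^sup>2) - 8 * R\<^sup>2"
      by (simp add: K_def k_def algebra_simps)
    then show ?thesis
      using quadratic_bound[OF \<kappa>(1), of "R\<^sup>2 - (norm (x - x0))\<^sup>2"] ball by (simp add: \<beta>_def)
  qed
  define \<gamma> where "\<gamma> = (p + 1) * \<kappa>"
  define t1 where "t1 = (t0 + T) / 2"
  have t1: "t0 < t1" "t1 < T" using t0 by (auto simp: t1_def)
  have ccl: "cball x0 R \<subseteq> closure \<Omega>" using ball in_closure by auto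
  have \<beta>0: "0 \<le> \<beta> x" for x by (simp add: \<beta>_def)
  have A0: "0 \<le> A x t" for x t by (simp add: A_def)
  have "0 < deriv (u x) t" if "x \<in> cball x0 R" "t0 \<le> t" "t \<le> t1" for x t
    using that ball t0 t1 by (intro ut_pos) auto
  then obtain c where c: "0 < c"
    "\<And>x h. x \<in> cball x0 R \<Longrightarrow> 0 < h \<Longrightarrow> h \<le> t1 - t0 \<Longrightarrow> c * h \<le> u x (t0 + h) - u x t0"
    using uniform_increment[OF compact_cball ball(1) t0(1) t1] by blast
  have Acont: "continuous_on S (\<lambda>z. A (fst z) (snd z))" if S: "S \<subseteq> closure \<Omega> \<times> {0..<T}" for S
  proof -
    have "1 - u (fst z) (snd z) \<noteq> 0" if "z \<in> S" for z
      using u_less_1[of "fst z" "snd z"] that S by auto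
    moreover have "continuous_on S (\<lambda>z. u (fst z) (snd z))"
      using S by (intro continuous_intros) auto
    ultimately have "continuous_on S (\<lambda>z. (1 - u (fst z) (snd z)) powr (- p))"
      by (intro continuous_on_powr continuous_on_diff continuous_on_const) auto
    moreover have "continuous_on S (\<lambda>z. \<beta> (fst z) powr (p + 1))"
      by (rule continuous_on_powr') (use \<beta>0 p_pos in \<open>auto simp: \<beta>_def intro!: continuous_intros\<close>)
    ultimately show ?thesis unfolding A_def by (intro continuous_on_mult)
  qed
  have "compact ((\<lambda>z. A (fst z) (snd z)) ` (cball x0 R \<times> {t0}))"
    using ccl t0 by (intro compact_continuous_image Acont compact_Times) auto
  then obtain B where B: "\<And>v. v \<in> (\<lambda>z. A (fst z) (snd z)) ` (cball x0 R \<times> {t0}) \<Longrightarrow> \<bar>v\<bar> \<le> B"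
    using compact_imp_bounded bounded_iff by (metis real_norm_def)
  have B: "A x t0 \<le> B" if "x \<in> cball x0 R" for x
    using B[OF imageI[of "(x, t0)"]] that by simp
  have B0: "0 \<le> B" using B[of x0] A0[of x0 t0] ball by simp
  \<comment> \<open>Makes \<delta> A at most \<open>c\<close> at time \<open>t0\<close>; adding 1
    covers B = 0.\<close>
  define \<delta> where "\<delta> = c / (B + 1)"
  have \<delta>: "0 < \<delta>" using c B0 by (simp add: \<delta>_def)
  \<comment> \<open>Neither \<delta> nor \<gamma> depends on \<open>h\<close> or \<open>t\<close>;
    the constant \<open>M\<close> in the proof does depend on \<open>t\<close>, but it does not
    enter the estimate.\<close>
  have increment: "\<delta> * h * exp (- \<gamma> * (t - t0)) * A x t \<le> u x (t + h) - u x t"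
    if x: "x \<in> cball x0 R" and t: "t0 \<le> t" and h: "0 < h" "h \<le> t1 - t0" "t + h < T" for x t h
  proof -
    define e where "e = (\<lambda>t. \<delta> * h * exp (- \<gamma> * (t - t0)))"
    have e: "0 < e s" for s using \<delta> h by (simp add: e_def)
    define J where "J = (\<lambda>x t. u x (t + h) - u x t - e t * A x t)"
    obtain M where M: "\<And>x s. x \<in> closure \<Omega> \<Longrightarrow> 0 \<le> s \<Longrightarrow> s \<le> t \<Longrightarrow> potential x s \<le> M"
      using potential_bounded[of t] h by auto
    have "0 \<le> J x t"
    proof (rule min_principle[where J = J and D = "ball x0 R" and M = M
          and ?t0.0 = t0 and ?t1.0 = t])
      have "continuous_on (cball x0 R \<times> {t0..t}) (\<lambda>(x, t). u x (t + h) - u x t)"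
        using t0 h ccl by (intro increment_cont) auto
      moreover have "continuous_on (cball x0 R \<times> {t0..t}) (\<lambda>z. A (fst z) (snd z))"
        using ccl t0 h by (intro Acont) auto
      ultimately show "continuous_on (closure (ball x0 R) \<times> {t0..t}) (\<lambda>(x, t). J x t)"
        using ball unfolding J_def e_def case_prod_beta by (auto intro!: continuous_intros)
    next
      fix x assume "x \<in> closure (ball x0 R)"
      then have x: "x \<in> cball x0 R" using ball by simp
      have "\<delta> * A x t0 \<le> \<delta> * (B + 1)" using B[OF x] \<delta> by (intro mult_left_mono) auto
      then have "\<delta> * A x t0 \<le> c" using B0 by (simp add: \<delta>_def)
      then have "e t0 * A x t0 \<le> c * h" using h by (simp add: e_def)
      with c(2)[OF x h(1,2)] show "0 \<le> J x t0" by (simp add: J_def)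
    next
      fix x s assume x: "x \<in> frontier (ball x0 R)" and s: "t0 \<le> s" "s \<le> t"
      then have "norm (x - x0) = R" using ball by (simp add: dist_norm norm_minus_commute)
      moreover have "x \<in> closure \<Omega>" using x ball ccl by auto
      ultimately show "0 \<le> J x s"
        using increment_nonneg[of x s h] s t0 h p_pos by (simp add: J_def A_def \<beta>_def)
    next
      fix x s assume x: "x \<in> ball x0 R" and s: "t0 < s" "s \<le> t" and neg: "J x s < 0"
      have "x \<in> \<Omega>" using x ball by auto
      then have x': "x \<in> \<Omega>" "x \<in> closure \<Omega>" using in_closure by auto
      have s': "0 < s" "s < T" "s + h < T" using s t0 h by auto
      define y where "y = 1 - u x s"
      have y: "0 < y" using u_less_1[OF x'(2), of s] s' by (simp add: y_def)
      \<comment> \<open>If \<beta> vanished, \<open>J\<close> would equal the nonnegative increment.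
        Hence the slope of contact \<open>r\<close> is positive.\<close>
      have "\<beta> x \<noteq> 0"
        using neg increment_nonneg[OF x'(2), of s h] s' h p_pos by (auto simp: J_def A_def)
      then have b: "0 < \<beta> x" using \<beta>0[of x] by simp
      define r where "r = \<beta> x / y"
      have r: "0 < r" using b y by (simp add: r_def)
      \<comment> \<open>The tangent plane of \<beta> powr (p + 1) * y powr (- p) along the ray
        \<beta> = r y. It equals \<open>A\<close> at the point and lies below \<open>A\<close>
        nearby, so subtracting it touches \<open>J\<close> from above.\<close>
      define P where "P = (\<lambda>x t. ((p + 1) * r powr p) * \<beta> x + (- p * r powr (p + 1)) * (1 * 1 + (- 1) * u x t))"
      have ry: "\<beta> x = r * y" using y by (simp add: r_def)
      have uy: "1 * 1 + (- 1) * u x s = y" by (simp add: y_def)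
      have contact: "P x s = r powr p * \<beta> x"
        unfolding P_def uy ry using r by (simp add: powr_add algebra_simps)
      have A_contact: "A x s = r powr p * \<beta> x"
        unfolding A_def y_def[symmetric] ry
        using r y by (simp add: powr_mult powr_add powr_minus field_simps)
      define F where "F = f x * y powr (- p)"
      have heat_P: "heat_at P x s (((p + 1) * r powr p) * K x + (- p * r powr (p + 1)) * (1 * 0 + (- 1) * F))"
      proof -
        have "((\<lambda>t::real. R\<^sup>2) has_real_derivative 0) (at s)" by simp
        from heat_at_quad_square[OF this, of x0 x]
        have "heat_at (\<lambda>x t. \<beta> x) x s (K x)" by (simp add: \<beta>_def K_def)
        moreover have "heat_at (\<lambda>x t. 1) x s 0" by (rule heat_at_time[OF DERIV_const])
        moreover have "heat_at u x s F"
          unfolding F_def y_def by (rule pde) (use x' s' in auto)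
        ultimately show ?thesis unfolding P_def by (intro heat_at_lincomb)
      qed
      have "(e has_real_derivative (- \<gamma> * e s)) (at s)"
        unfolding e_def by (auto intro!: derivative_eq_intros)
      note heat_eP = heat_at_time_mult[OF heat_P this]
      obtain H where H: "heat_at (\<lambda>x t. u x (t + h) - u x t) x s H"
        "potential x s * (u x (s + h) - u x s) \<le> H"
        using heat_increment[OF x'(1) s'(1) h(1) s'(3)] by blast
      define \<psi> where "\<psi> = (\<lambda>x t. 1 * (u x (t + h) - u x t) + (- 1) * (e t * P x t))"
      define H' where "H' = 1 * H + (- 1) * (- \<gamma> * e s * P x s + e s *
         (((p + 1) * r powr p) * K x + (- p * r powr (p + 1)) * (1 * 0 + (- 1) * F)))"
      have heat: "heat_at \<psi> x s H'"
        unfolding \<psi>_def H'_def by (rule heat_at_lincomb[OF H(1) heat_eP])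
      \<comment> \<open>The source contribution of \<open>u\<close> to the tangent plane is exactly
        the potential times the contact value. What remains is the \<beta> part, whose sign is
        settled by \<gamma> = (p + 1) \<kappa>.\<close>
      have "p * r powr (p + 1) * F = potential x s * (r powr p * \<beta> x)"
        unfolding potential_def F_def y_def[symmetric] ry
        using r y by (simp add: powr_add powr_diff field_simps)
      then have "H' = H - potential x s * (e s * P x s) + e s * r powr p * (\<gamma> * \<beta> x - (p + 1) * K x)"
        unfolding H'_def contact by (simp add: algebra_simps)
      moreover have "0 \<le> e s * r powr p * (\<gamma> * \<beta> x - (p + 1) * K x)"
        using e[of s] K[of x] p_pos by (intro mult_nonneg_nonneg) (auto simp: \<gamma>_def mult.assoc)
      moreover have "potential x s * J x s = potential x s * (u x (s + h) - u x s) - potential x s * (e s * P x s)"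
        by (simp add: J_def contact A_contact algebra_simps)
      ultimately have "potential x s * J x s \<le> H'" using H(2) by linarith
      moreover have "M * J x s \<le> potential x s * J x s"
        using neg M[OF x'(2), of s] s s' by (intro mult_right_mono_neg) auto
      ultimately have HM: "M * J x s \<le> H'" by simp
      have "\<forall>\<^sub>F z in nhds (x, s). z \<in> \<Omega> \<times> {0<..<T}"
        using open_dom x' s' by (intro eventually_nhds_in_open open_Times) auto
      then have "\<forall>\<^sub>F z in nhds (x, s). J (fst z) (snd z) \<le> \<psi> (fst z) (snd z)"
      proof eventually_elim
        case (elim z)
        then have "P (fst z) (snd z) \<le> A (fst z) (snd z)"
          using perspective_powr_above_tangent[OF \<beta>0[of "fst z"] _ r p_pos, of "1 - u (fst z) (snd z)"]
            u_less_1[of "fst z" "snd z"] in_closure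
          by (auto simp: P_def A_def)
        then show ?case using e[of "snd z"] by (simp add: J_def \<psi>_def)
      qed
      moreover have "\<psi> x s = J x s" by (simp add: \<psi>_def J_def contact A_contact)
      ultimately show "\<exists>\<psi> H. \<psi> x s = J x s \<and> (\<forall>\<^sub>F z in nhds (x, s). J (fst z) (snd z) \<le> \<psi> (fst z) (snd z)) \<and>
         heat_at \<psi> x s H \<and> M * J x s \<le> H"
        using heat HM by blast
    qed (use x t ball in auto)
    then show ?thesis by (simp add: J_def e_def)
  qed
  \<comment> \<open>The exponential is taken at its lower bound at time \<open>T\<close>, and
    \<beta> at its lower bound on the half ball.\<close>
  define \<epsilon> where "\<epsilon> = \<delta> * exp (- \<gamma> * (T - t0)) * ((R\<^sup>2 - (R / 2)\<^sup>2)\<^sup>2) powr (p + 1)"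
  have "0 < (R\<^sup>2 - (R / 2)\<^sup>2)\<^sup>2" using ball by (simp add: power2_eq_square)
  then have "0 < \<epsilon>" using \<delta> by (simp add: \<epsilon>_def)
  moreover have "\<epsilon> * (1 - u x t) powr (- p) \<le> deriv (u x) t"
    if x: "x \<in> cball x0 (R / 2)" and t: "t0 \<le> t" "t < T" for x t
  proof -
    have xR: "x \<in> cball x0 R" using x ball by simp
    have "\<delta> * exp (- \<gamma> * (t - t0)) * A x t \<le> deriv (u x) t"
    proof (rule derivative_ge_of_increments[where ?h0.0 = "min (t1 - t0) (T - t)"])
      show "(u x has_real_derivative deriv (u x) t) (at t)"
        using xR ball t t0 by (intro u_deriv) auto
      show "\<delta> * exp (- \<gamma> * (t - t0)) * A x t * h \<le> u x (t + h) - u x t"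
        if "0 < h" "h < min (t1 - t0) (T - t)" for h
        using increment[OF xR t(1), of h] that by (simp add: mult_ac)
    qed (use t1 t in auto)
    moreover have "\<epsilon> * (1 - u x t) powr (- p) \<le> \<delta> * exp (- \<gamma> * (t - t0)) * A x t"
    proof -
      have "exp (- \<gamma> * (T - t0)) \<le> exp (- \<gamma> * (t - t0))"
        using t \<kappa> p_pos by (simp add: \<gamma>_def mult_left_mono)
      moreover have "((R\<^sup>2 - (R / 2)\<^sup>2)\<^sup>2) powr (p + 1) \<le> \<beta> x powr (p + 1)"
      proof -
        have "(norm (x - x0))\<^sup>2 \<le> (R / 2)\<^sup>2"
          using x by (intro power_mono) (auto simp: dist_norm norm_minus_commute)
        moreover have "0 \<le> R\<^sup>2 - (R / 2)\<^sup>2" by (simp add: power2_eq_square)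
        ultimately have "(R\<^sup>2 - (R / 2)\<^sup>2)\<^sup>2 \<le> \<beta> x"
          unfolding \<beta>_def by (intro power_mono) auto
        then show ?thesis using p_pos by (intro powr_mono2) auto
      qed
      ultimately have "exp (- \<gamma> * (T - t0)) * ((R\<^sup>2 - (R / 2)\<^sup>2)\<^sup>2) powr (p + 1)
          \<le> exp (- \<gamma> * (t - t0)) * \<beta> x powr (p + 1)"
        by (intro mult_mono) auto
      then have "\<delta> * (1 - u x t) powr (- p) * (exp (- \<gamma> * (T - t0)) * ((R\<^sup>2 - (R / 2)\<^sup>2)\<^sup>2) powr (p + 1))
          \<le> \<delta> * (1 - u x t) powr (- p) * (exp (- \<gamma> * (t - t0)) * \<beta> x powr (p + 1))"
        using \<delta> by (intro mult_left_mono) auto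
      then show ?thesis by (simp add: \<epsilon>_def A_def mult_ac)
    qed
    ultimately show ?thesis by simp
  qed
  ultimately show thesis by (rule that)
qed

text \<open>By \<open>ut_lower_bound\<close>, (1 - u) powr (p + 1) decreases at rate at least (p +
  1) \<epsilon>. As it stays nonnegative up to \<open>T\<close>, its value at \<open>t\<close> is at
  least (p + 1) \<epsilon> (T - t).\<close>

lemma type_I_estimate:
  assumes ball: "cball x0 R \<subseteq> \<Omega>" "0 < R" and t0: "0 < t0" "t0 < T"
  obtains c where "0 < c"
    "\<And>x t. x \<in> cball x0 (R / 2) \<Longrightarrow> t0 \<le> t \<Longrightarrow> t < T \<Longrightarrow>
        c * (T - t) powr (1 / (p + 1)) \<le> 1 - u x t"
proof -
  obtain \<epsilon> where \<epsilon>: "0 < \<epsilon>"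
    "\<And>x t. x \<in> cball x0 (R / 2) \<Longrightarrow> t0 \<le> t \<Longrightarrow> t < T \<Longrightarrow>
        \<epsilon> * (1 - u x t) powr (- p) \<le> deriv (u x) t"
    using ut_lower_bound[OF assms] by blast
  define c where "c = ((p + 1) * \<epsilon>) powr (1 / (p + 1))"
  have "0 < c" using \<epsilon> p_pos by (simp add: c_def)
  moreover have "c * (T - t) powr (1 / (p + 1)) \<le> 1 - u x t"
    if x: "x \<in> cball x0 (R / 2)" and t: "t0 \<le> t" "t < T" for x t
  proof -
    have "x \<in> cball x0 R" using x ball by simp
    then have x': "x \<in> \<Omega>" "x \<in> closure \<Omega>" using ball in_closure by auto
    have step: "(p + 1) * \<epsilon> * (t' - t) \<le> (1 - u x t) powr (p + 1)" if t': "t < t'" "t' < T" for t'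
    proof -
      let ?g' = "\<lambda>s. (p + 1) * (1 - u x s) powr p * deriv (u x) s"
      have "((\<lambda>s. - ((1 - u x s) powr (p + 1))) has_real_derivative ?g' s) (at s)"
        if "t \<le> s" "s \<le> t'" for s
      proof -
        have "0 < 1 - u x s" using u_less_1[OF x'(2), of s] that t t' t0 by auto
        then show ?thesis
          using u_deriv[OF x'(1), of s] that t t' t0
          by (auto intro!: derivative_eq_intros)
      qed
      from MVT2[OF t'(1) this] obtain s where s: "t < s" "s < t'"
        "- ((1 - u x t') powr (p + 1)) - - ((1 - u x t) powr (p + 1)) = (t' - t) * ?g' s"
        by auto
      have y: "0 < 1 - u x s" using u_less_1[OF x'(2), of s] s t t' t0 by auto
      have "\<epsilon> = (1 - u x s) powr p * (\<epsilon> * (1 - u x s) powr (- p))"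
        using y by (simp add: powr_minus)
      also have "\<dots> \<le> (1 - u x s) powr p * deriv (u x) s"
        using \<epsilon>(2)[OF x, of s] s t t' by (intro mult_left_mono) auto
      finally have "(t' - t) * ((p + 1) * \<epsilon>) \<le> (t' - t) * ?g' s"
        using t' p_pos by (simp add: mult.assoc)
      moreover have "0 \<le> (1 - u x t') powr (p + 1)" by simp
      moreover have "(p + 1) * \<epsilon> * (t' - t) = (t' - t) * ((p + 1) * \<epsilon>)" by simp
      ultimately show ?thesis using s(3) by linarith
    qed
    have "(p + 1) * \<epsilon> * (T - t) \<le> (1 - u x t) powr (p + 1)"
    proof (rule dense_le)
      fix v assume v: "v < (p + 1) * \<epsilon> * (T - t)"
      define \<alpha> where "\<alpha> = (p + 1) * \<epsilon>"
      have \<alpha>: "0 < \<alpha>" using \<epsilon> p_pos by (simp add: \<alpha>_def)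
      \<comment> \<open>The solution lives only before \<open>T\<close>, so a value \<open>v\<close>
        below the target is reached with t' < T; the midpoint keeps t' > t when \<open>v\<close> is
        not positive.\<close>
      define t' where "t' = max (t + v / \<alpha>) ((t + T) / 2)"
      have "v / \<alpha> < T - t" using v \<alpha> unfolding \<alpha>_def[symmetric] by (simp add: pos_divide_less_eq mult.commute)
      then have t': "t < t'" "t' < T" "v / \<alpha> \<le> t' - t" using t by (auto simp: t'_def less_max_iff_disj)
      have "v \<le> \<alpha> * (t' - t)" using t'(3) \<alpha> by (simp add: pos_divide_le_eq mult.commute)
      with step[OF t'(1,2)] show "v \<le> (1 - u x t) powr (p + 1)" by (simp add: \<alpha>_def)
    qed
    then have "((p + 1) * \<epsilon> * (T - t)) powr (1 / (p + 1)) \<le> ((1 - u x t) powr (p + 1)) powr (1 / (p + 1))"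
      using \<epsilon> p_pos t by (intro powr_mono2) auto
    also have "\<dots> = 1 - u x t"
      using u_less_1[OF x'(2), of t] t t0 p_pos by (simp add: powr_powr)
    also have "((p + 1) * \<epsilon> * (T - t)) powr (1 / (p + 1)) = c * (T - t) powr (1 / (p + 1))"
      using \<epsilon> p_pos t by (simp add: c_def powr_mult)
    finally show ?thesis .
  qed
  ultimately show thesis by (rule that)
qed

text \<open>On a ball of radius \<open>r\<close> over the last time span \<open>r\<^sup>2\<close>, both the deficit \<open>1 - u\<close> inherited
  from the initial time and the total contribution of the source scale like \<open>(r\<^sup>2) powr (1 / (p + 1))\<close>,
  the latter with the small factor \<open>\<eta>\<close> bounding \<open>f\<close>.\<close>

lemma no_quenching_near_zero:
  assumes x0: "x0 \<in> \<Omega>" "f x0 = 0"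
  obtains r \<tau> d where "0 < r" "0 < d" "\<tau> < T"
    "\<And>x t. x \<in> ball x0 r \<Longrightarrow> \<tau> < t \<Longrightarrow> t < T \<Longrightarrow> d \<le> 1 - u x t"
proof -
  obtain R where R: "0 < R" "cball x0 R \<subseteq> \<Omega>" using x0 open_dom open_contains_cball by blast
  define t0 where "t0 = T / 2"
  have t0: "0 < t0" "t0 < T" using T_pos by (auto simp: t0_def)
  define q where "q = 1 / (p + 1)"
  \<comment> \<open>The identity - p q = q - 1 turns the rate estimate into a source bound of order
    (T - t) powr (q - 1), which is integrable up to \<open>T\<close>.\<close>
  have q: "0 < q" "(p + 1) * q = 1" "- p * q = q - 1" using p_pos by (auto simp: q_def field_simps)
  obtain c where c: "0 < c"
    "\<And>x t. x \<in> cball x0 (R / 2) \<Longrightarrow> t0 \<le> t \<Longrightarrow> t < T \<Longrightarrow> c * (T - t) powr q \<le> 1 - u x t"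
    using type_I_estimate[OF R(2,1) t0] unfolding q_def by blast
  define k where "k = 4 * real (DIM('a)) + 8"
  \<comment> \<open>The fraction of the deficit that the barrier preserves: its exponential decay
    over a time span \<open>r\<^sup>2\<close>, times (3/4)^2 from the half ball. It does not involve
    \<open>r\<close>, which is chosen only after \<eta>.\<close>
  define E where "E = exp (- (k\<^sup>2 / 32)) * (9 / 16)"
  have E: "0 < E" by (simp add: E_def)
  \<comment> \<open>Chosen so that \<open>a\<close> below equals c E / 2: the source can consume at
    most half of the preserved deficit.\<close>
  define \<eta> where "\<eta> = c * c powr p * E / (2 * (p + 1))"
  have \<eta>: "0 < \<eta>" using c E p_pos by (simp add: \<eta>_def)
  have "isCont f x0"
    using f_cont x0 open_dom closure_subset
    by (meson continuous_on_subset continuous_on_eq_continuous_at)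
  then have "(f \<longlongrightarrow> f x0) (nhds x0)"
    by (simp add: isCont_def tendsto_at_iff_tendsto_nhds)
  from order_tendstoD(2)[OF this, of \<eta>]
  have "\<forall>\<^sub>F x in nhds x0. f x < \<eta>" using x0 \<eta> by simp
  then obtain r0 where r0: "0 < r0" "\<And>x. dist x x0 < r0 \<Longrightarrow> f x < \<eta>"
    unfolding eventually_nhds_metric by blast
  \<comment> \<open>The square root ensures that the last time span \<open>r\<^sup>2\<close> starts
    no earlier than \<open>t0\<close>.\<close>
  define r where "r = min (min r0 (R / 2)) (sqrt (T / 2))"
  have r: "0 < r" "r \<le> r0" "r \<le> R / 2" using r0 R T_pos by (auto simp: r_def)
  have "r\<^sup>2 \<le> (sqrt (T / 2))\<^sup>2" using r by (intro power_mono) (auto simp: r_def)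
  then have r2: "r\<^sup>2 \<le> T - t0" using T_pos by (simp add: t0_def)
  have r\<Omega>: "cball x0 r \<subseteq> \<Omega>" using R r by (auto simp: subset_iff)
  define \<tau> where "\<tau> = T - r\<^sup>2"
  have \<tau>: "t0 \<le> \<tau>" "\<tau> < T" "T - \<tau> = r\<^sup>2" using r r2 by (auto simp: \<tau>_def)
  define \<sigma> where "\<sigma> = (r\<^sup>2) powr q"
  have \<sigma>: "0 < \<sigma>" using r by (simp add: \<sigma>_def)
  define a where "a = \<eta> * c powr (- p) * (p + 1)"
  have "0 < a" using \<eta> c p_pos by (simp add: a_def)
  have "a = (c * E / 2) * (c powr p * c powr (- p)) * ((p + 1) / (p + 1))"
    unfolding a_def \<eta>_def by (simp only: times_divide_eq_left times_divide_eq_right) (simp add: mult_ac)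
  also have "\<dots> = c * E / 2" using c p_pos by (simp add: powr_add[symmetric])
  finally have a: "0 < a" "a = c * E / 2" using \<open>0 < a\<close> by simp_all
  \<comment> \<open>The deficit plus a time-dependent correction that vanishes at \<tau> and grows
    at least as fast as the source can act. So \<open>V\<close> is a supersolution of the heat
    equation, and it exceeds the deficit by at most a \<sigma>.\<close>
  define V where "V = (\<lambda>x t. 1 * (a * (\<sigma> - (T - t) powr q) + 1) + (- 1) * u x t)"
  define \<kappa> where "\<kappa> = k\<^sup>2 / (32 * r\<^sup>2)"
  have "c * \<sigma> * E / 2 \<le> 1 - u x t" if x: "x \<in> ball x0 (r / 2)" and t: "\<tau> < t" "t < T" for x t
  proof -
    have r_half: "(r / 2)\<^sup>2 \<le> r\<^sup>2" using r by (intro power_mono) auto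
    have norm_x: "(norm (x - x0))\<^sup>2 \<le> (r / 2)\<^sup>2"
      using x by (intro power_mono) (auto simp: dist_norm norm_minus_commute)
    have time: "(T - s) powr q \<le> \<sigma>" if "\<tau> \<le> s" "s < T" for s
      unfolding \<sigma>_def using that \<tau> q by (intro powr_mono2) auto
    have "c * \<sigma> / (r\<^sup>2)\<^sup>2 * exp (- \<kappa> * (t - \<tau>)) * (r\<^sup>2 + 0 * (t - \<tau>) - (norm (x - x0))\<^sup>2)\<^sup>2 \<le> V x t"
    proof (rule expanding_ball_lower_bound[where w = V and R = r and ?t0.0 = \<tau> and ?t1.0 = t
          and y = x0 and \<rho> = r and s = 0 and \<kappa> = \<kappa> and m = "c * \<sigma> / (r\<^sup>2)\<^sup>2"])
      show "(2 * (0::real) + 4 * DIM('a) + 8)\<^sup>2 \<le> 32 * \<kappa> * r\<^sup>2"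
        using r by (simp add: \<kappa>_def k_def)
      show "continuous_on (cball x0 r \<times> {\<tau>..t}) (\<lambda>(x, t). V x t)"
        unfolding V_def case_prod_beta using t r\<Omega> in_closure \<tau> t0
        by (intro continuous_intros) auto
      show "0 \<le> V x s" if "x \<in> cball x0 r" "\<tau> \<le> s" "s \<le> t" for x s
      proof -
        have "u x s < 1" using that r\<Omega> in_closure \<tau> t t0 by (intro u_less_1) auto
        moreover have "0 \<le> a * (\<sigma> - (T - s) powr q)"
          using time[of s] that t a by (intro mult_nonneg_nonneg) auto
        ultimately show ?thesis by (simp add: V_def)
      qed
      show "\<exists>H\<ge>0. heat_at V x s H" if x: "x \<in> ball x0 r" and s: "\<tau> < s" "s \<le> t" for x s
      proof -
        have "x \<in> \<Omega>" using x r\<Omega> by auto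
        then have x': "x \<in> \<Omega>" "x \<in> closure \<Omega>" "x \<in> cball x0 (R / 2)" "dist x x0 < r0"
          using x in_closure r by (auto simp: dist_commute)
        have s': "0 < s" "s < T" "t0 \<le> s" using s \<tau> t t0 by auto
        have "((\<lambda>t. a * (\<sigma> - (T - t) powr q) + 1) has_real_derivative (a * q * (T - s) powr (q - 1))) (at s)"
          using s' by (auto intro!: derivative_eq_intros)
        from heat_at_lincomb[OF heat_at_time[OF this] pde[OF x'(1) s'(1,2)], of 1 "- 1"]
        have "heat_at V x s (1 * (a * q * (T - s) powr (q - 1)) + (- 1) * (f x * (1 - u x s) powr (- p)))"
          unfolding V_def .
        moreover have "f x * (1 - u x s) powr (- p) \<le> a * q * (T - s) powr (q - 1)"
        proof -
          have "0 < c * (T - s) powr q" using c s' by simp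
          then have "(1 - u x s) powr (- p) \<le> (c * (T - s) powr q) powr (- p)"
            using c(2)[OF x'(3) s'(3) s'(2)] p_pos by (intro powr_mono2') auto
          also have "\<dots> = c powr (- p) * (T - s) powr (q - 1)"
            using c s' q(3) by (simp add: powr_mult powr_powr mult.commute)
          finally have "f x * (1 - u x s) powr (- p) \<le> \<eta> * (c powr (- p) * (T - s) powr (q - 1))"
            using r0(2)[OF x'(4)] f_nonneg[OF x'(2)] \<eta> by (intro mult_mono) auto
          moreover have "a * q = \<eta> * c powr (- p)"
            using q(2) by (simp add: a_def mult.assoc)
          ultimately show ?thesis by (simp add: mult.assoc)
        qed
        ultimately show ?thesis
          by (intro exI[of _ "1 * (a * q * (T - s) powr (q - 1)) + (- 1) * (f x * (1 - u x s) powr (- p))"]) auto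
      qed
      show "c * \<sigma> / (r\<^sup>2)\<^sup>2 * (r\<^sup>2 - (norm (x - x0))\<^sup>2)\<^sup>2 \<le> V x \<tau>" if x: "x \<in> ball x0 r" for x
      proof -
        have "(norm (x - x0))\<^sup>2 \<le> r\<^sup>2"
          using x by (intro power_mono) (auto simp: dist_norm norm_minus_commute)
        then have "(r\<^sup>2 - (norm (x - x0))\<^sup>2)\<^sup>2 \<le> (r\<^sup>2)\<^sup>2" by (intro power_mono) auto
        then have "c * \<sigma> / (r\<^sup>2)\<^sup>2 * (r\<^sup>2 - (norm (x - x0))\<^sup>2)\<^sup>2 \<le> c * \<sigma> / (r\<^sup>2)\<^sup>2 * (r\<^sup>2)\<^sup>2"
          using c \<sigma> by (intro mult_left_mono) auto
        also have "\<dots> = c * \<sigma>" using r by simp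
        also have "\<dots> \<le> 1 - u x \<tau>"
          using c(2)[of x \<tau>] x r \<tau> by (auto simp: \<sigma>_def)
        also have "\<dots> = V x \<tau>" using \<tau> by (simp add: V_def \<sigma>_def)
        finally show ?thesis .
      qed
      show "(norm (x - x0))\<^sup>2 \<le> r\<^sup>2 + 0 * (t - \<tau>)" using norm_x r_half by simp
    qed (use r c \<sigma> x t in \<open>auto simp: \<kappa>_def\<close>)
    moreover have "c * \<sigma> * E \<le> c * \<sigma> / (r\<^sup>2)\<^sup>2 * exp (- \<kappa> * (t - \<tau>)) * (r\<^sup>2 + 0 * (t - \<tau>) - (norm (x - x0))\<^sup>2)\<^sup>2"
    proof -
      have "\<kappa> * (t - \<tau>) \<le> \<kappa> * r\<^sup>2" using t \<tau> by (intro mult_left_mono) (auto simp: \<kappa>_def)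
      also have "\<dots> = k\<^sup>2 / 32" using r by (simp add: \<kappa>_def)
      finally have "exp (- (k\<^sup>2 / 32)) \<le> exp (- \<kappa> * (t - \<tau>))" by simp
      moreover have "9 / 16 * (r\<^sup>2)\<^sup>2 \<le> (r\<^sup>2 - (norm (x - x0))\<^sup>2)\<^sup>2"
      proof -
        have "(3 / 4 * r\<^sup>2)\<^sup>2 \<le> (r\<^sup>2 - (norm (x - x0))\<^sup>2)\<^sup>2"
          using norm_x by (intro power_mono) (auto simp: power_divide)
        then show ?thesis by (simp add: power_mult_distrib power_divide)
      qed
      ultimately have "exp (- (k\<^sup>2 / 32)) * (9 / 16 * (r\<^sup>2)\<^sup>2) \<le> exp (- \<kappa> * (t - \<tau>)) * (r\<^sup>2 - (norm (x - x0))\<^sup>2)\<^sup>2"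
        by (intro mult_mono) auto
      then have "c * \<sigma> / (r\<^sup>2)\<^sup>2 * (exp (- (k\<^sup>2 / 32)) * (9 / 16 * (r\<^sup>2)\<^sup>2))
          \<le> c * \<sigma> / (r\<^sup>2)\<^sup>2 * (exp (- \<kappa> * (t - \<tau>)) * (r\<^sup>2 - (norm (x - x0))\<^sup>2)\<^sup>2)"
        using c \<sigma> by (intro mult_left_mono) auto
      then show ?thesis using r by (simp add: E_def mult_ac)
    qed
    moreover have "V x t \<le> 1 - u x t + a * \<sigma>"
      using a by (simp add: V_def algebra_simps)
    moreover have "a * \<sigma> = c * \<sigma> * E / 2" by (simp add: a(2))
    ultimately show ?thesis by linarith
  qed
  then show thesis
    using that[of "r / 2" "c * \<sigma> * E / 2" \<tau>] r c \<sigma> E \<tau> by simp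
qed

end

section \<open>From classical solutions to the theorem\<close>

text \<open>\<open>partial\<close> differentiates at parameter 0 of the line through its base point.
  Moving the base point along the line and shifting the parameter yields the derivative at all
  nearby parameters.\<close>

lemma C21_imp_heat_at:
  fixes u :: "'a::euclidean_space \<Rightarrow> real \<Rightarrow> real"
  assumes C21: "C21_on \<Omega> I u" and "open \<Omega>" "x \<in> \<Omega>" "t \<in> I"
  shows "heat_at u x t (deriv (u x) t - laplacian (\<lambda>y. u y t) x)"
proof (rule heat_atI)
  show "(u x has_real_derivative deriv (u x) t) (at t)"
    using assms by (auto simp: C21_on_def DERIV_deriv_iff_field_differentiable)
  show "deriv (u x) t - laplacian (\<lambda>y. u y t) x
      = deriv (u x) t - (\<Sum>b\<in>Basis. partial b (partial b (\<lambda>y. u y t)) x)"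
    by (simp add: laplacian_def)
  fix b :: 'a assume b: "b \<in> Basis"
  let ?g = "\<lambda>y. u y t"
  have C2: "C2_on \<Omega> ?g" using assms by (auto simp: C21_on_def)
  have line: "((\<lambda>s. h (z + s *\<^sub>R b)) has_real_derivative partial b h z) (at 0)"
    if "has_partial b h z" for h :: "'a \<Rightarrow> real" and z
    using that by (simp add: has_partial_def partial_def DERIV_deriv_iff_field_differentiable)
  have "((\<lambda>s. x + s *\<^sub>R b) \<longlongrightarrow> x + 0 *\<^sub>R b) (nhds 0)"
    by (intro tendsto_intros filterlim_ident)
  then have "\<forall>\<^sub>F s in nhds 0. x + s *\<^sub>R b \<in> \<Omega>"
    using eventually_compose_filterlim[OF eventually_nhds_in_open[OF \<open>open \<Omega>\<close> \<open>x \<in> \<Omega>\<close>]] by simp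
  then have "\<forall>\<^sub>F s in nhds 0. ((\<lambda>s. ?g (x + s *\<^sub>R b)) has_real_derivative partial b ?g (x + s *\<^sub>R b)) (at s)"
  proof eventually_elim
    case (elim s)
    then have "has_partial b ?g (x + s *\<^sub>R b)" using C2 b by (auto simp: C2_on_def)
    from line[OF this]
    have "((\<lambda>\<sigma>. ?g (x + (\<sigma> + s) *\<^sub>R b)) has_real_derivative partial b ?g (x + s *\<^sub>R b)) (at 0)"
      by (simp add: scaleR_add_left add.commute add.left_commute)
    then show ?case using DERIV_shift[of "\<lambda>s. ?g (x + s *\<^sub>R b)" _ 0 s] by simp
  qed
  moreover have "has_partial b (partial b ?g) x" using C2 b assms(3) by (auto simp: C2_on_def)
  ultimately show "second_deriv_at0 (\<lambda>s. ?g (x + s *\<^sub>R b)) (partial b (partial b ?g) x)"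
    using line unfolding second_deriv_at0_def by (intro exI conjI)
qed

lemma holder_continuous_on_imp_continuous_on:
  assumes "holder_continuous_on S g"
  shows "continuous_on S g"
proof -
  obtain \<alpha> C where \<alpha>: "0 < \<alpha>" and C: "\<And>x y. x \<in> S \<Longrightarrow> y \<in> S \<Longrightarrow> \<bar>g x - g y\<bar> \<le> C * dist x y powr \<alpha>"
    using assms unfolding holder_continuous_on_def holder_with_def by blast
  show ?thesis
    unfolding continuous_on_def
  proof
    fix x assume x: "x \<in> S"
    have "((\<lambda>y. C * dist y x powr \<alpha>) \<longlongrightarrow> C * dist x x powr \<alpha>) (at x within S)"
      using \<alpha> by (intro tendsto_intros tendsto_powr') auto
    then have lim: "((\<lambda>y. C * dist y x powr \<alpha>) \<longlongrightarrow> 0) (at x within S)" by simp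
    have "\<forall>\<^sub>F y in at x within S. norm (g y - g x) \<le> C * dist y x powr \<alpha>"
      using C x by (auto simp: eventually_at_filter)
    then have "((\<lambda>y. g y - g x) \<longlongrightarrow> 0) (at x within S)"
      using lim by (rule Lim_null_comparison)
    then show "(g \<longlongrightarrow> g x) (at x within S)" by (simp add: LIM_zero_iff)
  qed
qed

lemma classical_solution_imp_mems_solution:
  fixes \<Omega> :: "'a::euclidean_space set"
  assumes dom: "open \<Omega>" "connected \<Omega>" "bounded \<Omega>" and "0 < p" "0 < T"
    and f: "continuous_on (closure \<Omega>) f" "\<forall>x\<in>closure \<Omega>. 0 \<le> f x" "\<exists>x\<in>closure \<Omega>. f x \<noteq> 0"
    and sol: "classical_solution \<Omega> p f (ereal T) u"
  shows "mems_solution \<Omega> f u p T"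
proof -
  have I: "{t. 0 < t \<and> ereal t < ereal T} = {0<..<T}" "{t. 0 \<le> t \<and> ereal t < ereal T} = {0..<T}"
    by auto
  have cont: "continuous_on (closure \<Omega> \<times> {0..<T}) (\<lambda>(x, t). u x t)"
    and C21: "C21_on \<Omega> {0<..<T} u"
    and less: "\<And>x t. x \<in> closure \<Omega> \<Longrightarrow> 0 \<le> t \<Longrightarrow> t < T \<Longrightarrow> u x t < 1"
    and eq: "\<And>x t. x \<in> \<Omega> \<Longrightarrow> 0 < t \<Longrightarrow> t < T \<Longrightarrow>
        deriv (u x) t = laplacian (\<lambda>y. u y t) x + f x * (1 - u x t) powr (- p)"
    and lat: "\<And>x t. x \<in> frontier \<Omega> \<Longrightarrow> 0 < t \<Longrightarrow> t < T \<Longrightarrow> u x t = 0"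
    and init: "\<And>x. x \<in> \<Omega> \<Longrightarrow> u x 0 = 0"
    using sol unfolding classical_solution_def I by auto
  \<comment> \<open>The initial condition is prescribed only inside the domain; continuity extends
    it to the boundary, which also settles the lateral condition at time 0.\<close>
  have "continuous_on (closure \<Omega>) (\<lambda>x. case (x, 0) of (x, t) \<Rightarrow> u x t)"
    by (rule continuous_on_compose2[OF cont]) (use \<open>0 < T\<close> in \<open>auto intro!: continuous_intros\<close>)
  then have u0: "u x 0 = 0" if "x \<in> closure \<Omega>" for x
    using continuous_constant_on_closure[of \<Omega> "\<lambda>x. u x 0" 0 x] init that by auto
  show ?thesis
  proof
    show "heat_at u x t (f x * (1 - u x t) powr (- p))" if "x \<in> \<Omega>" "0 < t" "t < T" for x t
      using C21_imp_heat_at[OF C21 dom(1), of x t] eq[OF that] that by simp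
    show "(u x has_real_derivative deriv (u x) t) (at t)" if "x \<in> \<Omega>" "0 < t" "t < T" for x t
      using C21 that by (auto simp: C21_on_def DERIV_deriv_iff_field_differentiable)
    show "continuous_on (\<Omega> \<times> {0<..<T}) (\<lambda>(x, t). deriv (u x) t)"
      using C21 by (simp add: C21_on_def)
    show "u x t = 0" if "x \<in> frontier \<Omega>" "0 \<le> t" "t < T" for x t
      using lat[of x t] u0[of x] that by (cases "t = 0") (auto simp: frontier_def)
  qed (fact dom assms(4,5) f(1,3) f(2)[rule_format] cont less u0)+
qed

theorem theorem1:
  fixes \<Omega> :: "(real ^ 'n) set" and f :: "real ^ 'n \<Rightarrow> real"
    and u :: "real ^ 'n \<Rightarrow> real \<Rightarrow> real"
    and \<nu> p :: real and T :: ereal and x0 :: "real ^ 'n"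
  assumes "0 < \<nu>" and "\<nu> \<le> 1" and "C2_holder_domain \<nu> \<Omega>"
    and "p > 0"
    and "holder_continuous_on (closure \<Omega>) f"
    and "\<forall>x\<in>closure \<Omega>. f x \<ge> 0"
    and "\<exists>x\<in>closure \<Omega>. f x \<noteq> 0"
    and "maximal_classical_solution \<Omega> p f T u"
    and "T < \<infinity>"
    and "x0 \<in> \<Omega>" and "f x0 = 0"
  shows "\<not> quenching_point \<Omega> T u x0"
proof
  assume "quenching_point \<Omega> T u x0"
  then obtain x t where x: "x \<longlonglongrightarrow> x0" and t: "(\<lambda>k::nat. ereal (t k)) \<longlonglongrightarrow> T"
    and tT: "\<And>k. ereal (t k) < T" and lim: "(\<lambda>k. u (x k) (t k)) \<longlonglongrightarrow> 1"
    unfolding quenching_point_def by blast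
  have sol: "0 < T" "classical_solution \<Omega> p f T u"
    using assms(8) by (auto simp: maximal_classical_solution_def)
  obtain T' where T': "T = ereal T'" "0 < T'"
    using sol(1) assms(9) by (cases T) auto
  have dom: "open \<Omega>" "connected \<Omega>" "bounded \<Omega>"
    using assms(3) by (auto simp: C2_holder_domain_def)
  have sol': "mems_solution \<Omega> f u p T'"
    by (rule classical_solution_imp_mems_solution[OF dom assms(4) T'(2)
          holder_continuous_on_imp_continuous_on[OF assms(5)] assms(6,7) sol(2)[unfolded T'(1)]])
  obtain r \<tau> d where r: "0 < r" and d: "0 < d" and "\<tau> < T'"
    and bound: "\<And>x t. x \<in> ball x0 r \<Longrightarrow> \<tau> < t \<Longrightarrow> t < T' \<Longrightarrow> d \<le> 1 - u x t"
    by (rule mems_solution.no_quenching_near_zero[OF sol' assms(10,11)]) (rule that)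
  have "\<forall>\<^sub>F k in sequentially. dist (x k) x0 < r" using tendstoD[OF x r] .
  moreover have "\<forall>\<^sub>F k in sequentially. ereal \<tau> < ereal (t k)"
    using order_tendstoD(1)[OF t, of "ereal \<tau>"] \<open>\<tau> < T'\<close> T' by simp
  moreover have "\<forall>\<^sub>F k in sequentially. 1 - d < u (x k) (t k)"
    using order_tendstoD(1)[OF lim, of "1 - d"] d by simp
  \<comment> \<open>Eventually the sequence lies in the region where \<open>u\<close> is at most 1 -
    d, against convergence of its values to 1.\<close>
  ultimately have "\<forall>\<^sub>F k in sequentially. False"
  proof eventually_elim
    case (elim k)
    then show ?case using bound[of "x k" "t k"] tT[of k] T' by (auto simp: dist_commute)
  qed
  then show False by simp
qed

end
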